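(* Consider the problem $\phi_*=\min_{u\in\mathcal Z}[\phi(u):=f_1(u)+f_2(u)+h(u)]$ under the assumptions in the context, and let $\overline C_\lambda=\dfrac{1+\lambda(M_2^++L_1+L_2)}{\sqrt{1+\lambda M_2^+}}$. The following statements hold about the static AICG method (described in the context) with inputs $\hat\rho>0$, $z_0\in Z$, $\lambda>0$, $\theta\in(0,1)$ with $\lambda M_1+\theta^2<1/2$: (a) it stops in $$\mathcal O\left(\left[\sqrt\lambda L_1+\frac{1+\theta\overline C_\lambda}{\sqrt\lambda}\right]^2\left[\frac{\phi(z_0)-\phi_*}{\hat\rho^2}\right]\right)$$ outer iterations; (b) if it stops with $\pi_S=\mathtt{true}$, then the first two arguments of its output triple $(\hat z,\hat v,\pi_S)$ satisfy $$\hat v\in\nabla f_1(\hat z)+\nabla f_2(\hat z)+\partial h(\hat z),\qquad\|\hat v\|\le\hat\rho;$$ (c) if $f_2$ is convex, then it always stops with $\pi_S=\mathtt{true}$.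
   Context: Assumptions. $\mathcal Z$ is a finite dimensional inner product space; $Z\subseteq\mathcal Z$ is nonempty and convex; $h\in\overline{\mathrm{Conv}}(Z)$ (proper lower semicontinuous convex, real-valued exactly on $Z$); $f_i\in\mathcal C_{m_i,M_i}(Z)$ with $(m_i,M_i)\in\mathbb R^2$, $i=1,2$, i.e. $f_i$ is continuously differentiable on $Z$ (finite on an open set containing $Z$) and $-\frac{m_i}2\|u-z\|^2\le f_i(u)-\ell_{f_i}(u;z)\le\frac{M_i}2\|u-z\|^2$ for $u,z\in Z$, where $\ell_f(u;z)=f(z)+\langle\nabla f(z),u-z\rangle$; $\phi_*>-\infty$. Put $M_i^+=\max\{0,M_i\}$, $m_i^+=\max\{0,m_i\}$, $L_i=\max\{m_i^+,M_i^+\}$. $\mathcal O(B)$ means at most $C\max\{1,B\}$ for a universal constant $C$. For given $\psi_s,\psi_n$ and $\psi=\psi_s+\psi_n$, let $\Delta_\mu(u;z,v)=\psi(z)-\psi(u)+\langle v,u-z\rangle+\frac\mu2\|u-z\|^2$. S.ACG$(\psi_s,\psi_n,y_0,\theta,\mu,L)$: set $A_0=0$, $\Gamma_0\equiv0$, $x_0=y_0$, and for $k\ge1$ compute $\tau_{k-1}=(1+\mu A_{k-1})/L$, $a_{k-1}=\frac12(\tau_{k-1}+\sqrt{\tau_{k-1}^2+4\tau_{k-1}A_{k-1}})$, $A_k=A_{k-1}+a_{k-1}$, $\tilde x_{k-1}=\frac{A_{k-1}}{A_k}y_{k-1}+\frac{a_{k-1}}{A_k}x_{k-1}$, $q_k=\ell_{\psi_s}(\cdot;\tilde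 x_{k-1})+\psi_n+\frac\mu2\|\cdot-\tilde x_{k-1}\|^2$, $y_k=\operatorname{argmin}_y\{\frac1Lq_k(y)+\frac12\|y-\tilde x_{k-1}\|^2\}$, $x_k=x_{k-1}+\frac{a_{k-1}}{1+\mu A_k}[L(y_k-\tilde x_{k-1})+\mu(y_k-x_{k-1})]$, $\gamma_{k-1}=q_k(y_k)+L\langle\tilde x_{k-1}-y_k,\cdot-y_k\rangle+\frac\mu2\|\cdot-y_k\|^2$, $\Gamma_k=\frac{A_{k-1}}{A_k}\Gamma_{k-1}+\frac{a_{k-1}}{A_k}\gamma_{k-1}$, $r_k=(x_0-x_k)/A_k$, $\eta_k=\psi(y_k)-\Gamma_k(x_k)-\langle r_k,y_k-x_k\rangle$, $\tilde r_k=r_k+\mu(y_k-x_k)$, $\tilde\eta_k=\eta_k-\frac\mu2\|y_k-x_k\|^2$. If $\frac1{1+\mu A_k}\|A_k\tilde r_k+y_k-y_0\|^2+2A_k\tilde\eta_k>\|y_k-y_0\|^2$, return $(y_0,\infty,\infty,\mathtt{false})$. If $\|\tilde r_k\|^2+2\tilde\eta_k\le\theta^2\|y_k-y_0\|^2$, let $\hat y_k=\operatorname{argmin}_u\{\ell_{\psi_s}(u;y_k)-\langle\tilde r_k,u\rangle+\frac L2\|u-y_k\|^2+\psi_n(u)\}$; if $\Delta_\mu(\hat y_k;y_k,\tilde r_k)>\tilde\eta_k$ return $(y_0,\infty,\infty,\mathtt{false})$, else return $(y_k,\tilde r_k,\tilde\eta_k,\mathtt{true})$. SREF applied to $(z,z_0,v)$: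 with $\psi_s=\lambda[\ell_{f_1}(\cdot;z_0)+f_2]+\frac12\|\cdot-z_0\|^2$, $\psi_n=\lambda h$, $L=\lambda M_2^++1$, compute $\hat z=\operatorname{argmin}_u\{\ell_{\psi_s}(u;z)-\langle v,u\rangle+\frac L2\|u-z\|^2+\psi_n(u)\}$, $v_r=v+L(z-\hat z)+\nabla\psi_s(\hat z)-\nabla\psi_s(z)$, $\hat v=\frac1\lambda(v_r+z_0-\hat z)+\nabla f_1(\hat z)-\nabla f_1(z_0)$; return $(\hat z,\hat v)$. Static AICG method: set $\mu=1$, $L=\lambda M_2^++1$. For $k=1,2,\dots$ (outer iterations): let $\psi_s^k=\lambda[\ell_{f_1}(\cdot;z_{k-1})+f_2]+\frac12\|\cdot-z_{k-1}\|^2$ and $(z_k,v_k,\varepsilon_k,\pi_k)$ be the output of S.ACG$(\psi_s^k,\lambda h,z_{k-1},\theta,\mu,L)$. If $\pi_k=\mathtt{false}$ or $\Delta_\mu(z_{k-1};z_k,v_k)>\varepsilon_k$ (with $\psi_s=\psi_s^k$, $\psi_n=\lambda h$), stop with output $(z_0,\infty,\mathtt{false})$. Otherwise let $(\hat z_k,\hat v_k)$ be the output of SREF applied to $(z_k,z_{k-1},v_k)$; if $\|\hat v_k\|\le\hat\rho$, stop with output $(\hat z_k,\hat v_k,\mathtt{true})$. The last component of the output is $\pi_S$.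
   Formalization: In (a) and (c), if Z has empty interior, each ∇f_i is also assumed L_i-Lipschitz on Z; in (c), f_2 is assumed convex and in C_{m_2,M_2} on some set D containing Z and all search points x̃_k visited by S.ACG. Without these, (a) and (c) can fail. *)

theory Defs
  imports "HOL-Analysis.Analysis"
begin

section \<open>Function classes\<close>

definition grad :: "('a::euclidean_space \<Rightarrow> real) \<Rightarrow> 'a \<Rightarrow> 'a" where
  "grad f x = (THE D. GDERIV f x :> D)"

text \<open>The linearization $\ell_f(u;z)$.\<close>

definition lin :: "('a::euclidean_space \<Rightarrow> real) \<Rightarrow> 'a \<Rightarrow> 'a \<Rightarrow> real" where
  "lin f z u = f z + grad f z \<bullet> (u - z)"

text \<open>The class $\mathcal C_{m,M}(Z)$. Functions are total in HOL; their values off an open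
  neighbourhood of \<open>Z\<close> are unconstrained, which stands for a function that is finite only on
  that neighbourhood.\<close>

definition curv_class :: "real \<Rightarrow> real \<Rightarrow> 'a::euclidean_space set \<Rightarrow> ('a \<Rightarrow> real) \<Rightarrow> bool" where
  "curv_class m M Z f \<longleftrightarrow>
     (\<exists>U. open U \<and> Z \<subseteq> U \<and> (\<forall>x\<in>U. \<exists>D. GDERIV f x :> D) \<and> continuous_on U (grad f)) \<and>
     (\<forall>u\<in>Z. \<forall>z\<in>Z. - (m / 2) * (norm (u - z))\<^sup>2 \<le> f u - lin f z u \<and>
                  f u - lin f z u \<le> M / 2 * (norm (u - z))\<^sup>2)"

text \<open>Proper lower semicontinuous convex functions that are real-valued exactly on \<open>Z\<close>.\<close>

definition conv_class :: "'a::euclidean_space set \<Rightarrow> ('a \<Rightarrow> ereal) \<Rightarrow> bool" where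
  "conv_class Z h \<longleftrightarrow>
     Z \<noteq> {} \<and> (\<forall>z. h z \<noteq> - \<infinity>) \<and> {z. \<bar>h z\<bar> \<noteq> \<infinity>} = Z \<and>
     (\<forall>x. h x \<le> Liminf (at x) h) \<and>
     (\<forall>x y t. 0 < t \<and> t < 1 \<longrightarrow>
        h ((1 - t) *\<^sub>R x + t *\<^sub>R y) \<le> ereal (1 - t) * h x + ereal t * h y)"

definition subdiff :: "('a::euclidean_space \<Rightarrow> ereal) \<Rightarrow> 'a \<Rightarrow> 'a set" where
  "subdiff h z = {s. \<forall>u. h z + ereal (s \<bullet> (u - z)) \<le> h u}"

definition argmin :: "('a \<Rightarrow> ereal) \<Rightarrow> 'a" where
  "argmin F = arg_min F (\<lambda>_. True)"

section \<open>The problem\<close>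

definition phi :: "('a::euclidean_space \<Rightarrow> real) \<Rightarrow> ('a \<Rightarrow> real) \<Rightarrow> ('a \<Rightarrow> ereal) \<Rightarrow> 'a \<Rightarrow> ereal" where
  "phi f1 f2 h u = ereal (f1 u + f2 u) + h u"

definition phi_star :: "('a::euclidean_space \<Rightarrow> real) \<Rightarrow> ('a \<Rightarrow> real) \<Rightarrow> ('a \<Rightarrow> ereal) \<Rightarrow> ereal" where
  "phi_star f1 f2 h = (INF u. phi f1 f2 h u)"

definition pos_part :: "real \<Rightarrow> real" where
  "pos_part M = max 0 M"

definition curv_max :: "real \<Rightarrow> real \<Rightarrow> real" where
  "curv_max m M = max (pos_part m) (pos_part M)"

definition C_bar :: "real \<Rightarrow> real \<Rightarrow> real \<Rightarrow> real \<Rightarrow> real" where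
  "C_bar lam M2 L1 L2 = (1 + lam * (pos_part M2 + L1 + L2)) / sqrt (1 + lam * pos_part M2)"

text \<open>The universal constant hidden in $\mathcal O(\cdot)$ is fixed here, outside every theorem.
  Quantifying it existentially inside a theorem about a type of class \<open>euclidean_space\<close> would
  let it depend on that type, hence on the dimension.\<close>

definition bigO_const :: real where
  "bigO_const = 100"

definition is_bigO :: "nat \<Rightarrow> real \<Rightarrow> bool" where
  "is_bigO N B \<longleftrightarrow> real N \<le> bigO_const * max 1 B"

section \<open>The accelerated composite gradient method S.ACG\<close>

definition Delta ::
  "('a::euclidean_space \<Rightarrow> real) \<Rightarrow> ('a \<Rightarrow> ereal) \<Rightarrow> real \<Rightarrow> 'a \<Rightarrow> 'a \<Rightarrow> 'a \<Rightarrow> ereal" where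
  "Delta psi_s psi_n mu u z v =
     (ereal (psi_s z) + psi_n z) - (ereal (psi_s u) + psi_n u)
       + ereal (v \<bullet> (u - z) + mu / 2 * (norm (u - z))\<^sup>2)"

record 'a acg_state =
  acg_A :: real
  acg_y :: 'a
  acg_x :: 'a
  acg_Gamma :: "'a \<Rightarrow> real"

definition acg_a :: "real \<Rightarrow> real \<Rightarrow> 'a acg_state \<Rightarrow> real" where
  "acg_a mu L s =
     (let tau = (1 + mu * acg_A s) / L in (tau + sqrt (tau\<^sup>2 + 4 * tau * acg_A s)) / 2)"

text \<open>The search point $\tilde x_{k-1}$ computed from the state after $k-1$ iterations.\<close>

definition acg_xt :: "real \<Rightarrow> real \<Rightarrow> ('a::euclidean_space) acg_state \<Rightarrow> 'a" where
  "acg_xt mu L s =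
     (let a = acg_a mu L s; A' = acg_A s + a
      in (acg_A s / A') *\<^sub>R acg_y s + (a / A') *\<^sub>R acg_x s)"

definition acg_step ::
  "('a::euclidean_space \<Rightarrow> real) \<Rightarrow> ('a \<Rightarrow> ereal) \<Rightarrow> real \<Rightarrow> real \<Rightarrow> 'a acg_state \<Rightarrow> 'a acg_state" where
  "acg_step psi_s psi_n mu L s =
     (let A = acg_A s; x = acg_x s;
          a = acg_a mu L s;
          A' = A + a;
          xt = acg_xt mu L s;
          q = (\<lambda>u. ereal (lin psi_s xt u) + psi_n u + ereal (mu / 2 * (norm (u - xt))\<^sup>2));
          y' = argmin (\<lambda>u. ereal (1 / L) * q u + ereal (1 / 2 * (norm (u - xt))\<^sup>2));
          x' = x + (a / (1 + mu * A')) *\<^sub>R (L *\<^sub>R (y' - xt) + mu *\<^sub>R (y' - x));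
          gam = (\<lambda>u. real_of_ereal (q y') + L * ((xt - y') \<bullet> (u - y'))
                       + mu / 2 * (norm (u - y'))\<^sup>2);
          Gam' = (\<lambda>u. A / A' * acg_Gamma s u + a / A' * gam u)
      in \<lparr>acg_A = A', acg_y = y', acg_x = x', acg_Gamma = Gam'\<rparr>)"

primrec acg_iter ::
  "('a::euclidean_space \<Rightarrow> real) \<Rightarrow> ('a \<Rightarrow> ereal) \<Rightarrow> 'a \<Rightarrow> real \<Rightarrow> real \<Rightarrow> nat \<Rightarrow> 'a acg_state" where
  "acg_iter psi_s psi_n y0 mu L 0 = \<lparr>acg_A = 0, acg_y = y0, acg_x = y0, acg_Gamma = (\<lambda>_. 0)\<rparr>"
| "acg_iter psi_s psi_n y0 mu L (Suc k) = acg_step psi_s psi_n mu L (acg_iter psi_s psi_n y0 mu L k)"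

definition refine ::
  "('a::euclidean_space \<Rightarrow> real) \<Rightarrow> ('a \<Rightarrow> ereal) \<Rightarrow> real \<Rightarrow> 'a \<Rightarrow> 'a \<Rightarrow> 'a" where
  "refine psi_s psi_n L z v =
     argmin (\<lambda>u. ereal (lin psi_s z u - v \<bullet> u + L / 2 * (norm (u - z))\<^sup>2) + psi_n u)"

text \<open>In output tuples, \<open>None\<close> in a vector component stands for the entry $\infty$.\<close>

type_synonym 'a acg_output = "'a \<times> 'a option \<times> ereal \<times> bool"

text \<open>What S.ACG does at the end of its \<open>k\<close>-th iteration: return a tuple, or go on (\<open>None\<close>).\<close>

definition sacg_return ::
  "('a::euclidean_space \<Rightarrow> real) \<Rightarrow> ('a \<Rightarrow> ereal) \<Rightarrow> 'a \<Rightarrow> real \<Rightarrow> real \<Rightarrow> real \<Rightarrow> nat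
     \<Rightarrow> 'a acg_output option" where
  "sacg_return psi_s psi_n y0 theta mu L k =
     (let s = acg_iter psi_s psi_n y0 mu L k;
          A = acg_A s; y = acg_y s; x = acg_x s;
          r = (1 / A) *\<^sub>R (y0 - x);
          eta = real_of_ereal (ereal (psi_s y) + psi_n y) - acg_Gamma s x - r \<bullet> (y - x);
          rt = r + mu *\<^sub>R (y - x);
          etat = eta - mu / 2 * (norm (y - x))\<^sup>2
      in if 1 / (1 + mu * A) * (norm (A *\<^sub>R rt + y - y0))\<^sup>2 + 2 * A * etat > (norm (y - y0))\<^sup>2
         then Some (y0, None, \<infinity>, False)
         else if (norm rt)\<^sup>2 + 2 * etat \<le> theta\<^sup>2 * (norm (y - y0))\<^sup>2
         then (if Delta psi_s psi_n mu (refine psi_s psi_n L y rt) y rt > ereal etat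
               then Some (y0, None, \<infinity>, False)
               else Some (y, Some rt, ereal etat, True))
         else None)"

text \<open>The result \<open>None\<close> means that S.ACG iterates forever.\<close>

definition sacg ::
  "('a::euclidean_space \<Rightarrow> real) \<Rightarrow> ('a \<Rightarrow> ereal) \<Rightarrow> 'a \<Rightarrow> real \<Rightarrow> real \<Rightarrow> real
     \<Rightarrow> 'a acg_output option" where
  "sacg psi_s psi_n y0 theta mu L =
     (if \<exists>k\<ge>1. sacg_return psi_s psi_n y0 theta mu L k \<noteq> None
      then sacg_return psi_s psi_n y0 theta mu L
             (LEAST k. k \<ge> 1 \<and> sacg_return psi_s psi_n y0 theta mu L k \<noteq> None)
      else None)"

text \<open>The search points at which S.ACG evaluates \<open>psi_s\<close> and its gradient before it returns.\<close>

definition sacg_search_points ::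
  "('a::euclidean_space \<Rightarrow> real) \<Rightarrow> ('a \<Rightarrow> ereal) \<Rightarrow> 'a \<Rightarrow> real \<Rightarrow> real \<Rightarrow> real \<Rightarrow> 'a set" where
  "sacg_search_points psi_s psi_n y0 theta mu L =
     {acg_xt mu L (acg_iter psi_s psi_n y0 mu L k) | k.
        \<forall>j. 1 \<le> j \<and> j \<le> k \<longrightarrow> sacg_return psi_s psi_n y0 theta mu L j = None}"

section \<open>The static AICG method\<close>

definition aicg_psi_s ::
  "('a::euclidean_space \<Rightarrow> real) \<Rightarrow> ('a \<Rightarrow> real) \<Rightarrow> real \<Rightarrow> 'a \<Rightarrow> 'a \<Rightarrow> real" where
  "aicg_psi_s f1 f2 lam z0 u = lam * (lin f1 z0 u + f2 u) + 1 / 2 * (norm (u - z0))\<^sup>2"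

definition aicg_psi_n :: "('a \<Rightarrow> ereal) \<Rightarrow> real \<Rightarrow> 'a \<Rightarrow> ereal" where
  "aicg_psi_n h lam u = ereal lam * h u"

definition aicg_L :: "real \<Rightarrow> real \<Rightarrow> real" where
  "aicg_L lam M2 = lam * pos_part M2 + 1"

definition sref ::
  "('a::euclidean_space \<Rightarrow> real) \<Rightarrow> ('a \<Rightarrow> real) \<Rightarrow> ('a \<Rightarrow> ereal) \<Rightarrow> real \<Rightarrow> real
     \<Rightarrow> 'a \<Rightarrow> 'a \<Rightarrow> 'a \<Rightarrow> 'a \<times> 'a" where
  "sref f1 f2 h lam M2 z z0 v =
     (let psi_s = aicg_psi_s f1 f2 lam z0;
          L = aicg_L lam M2;
          zh = refine psi_s (aicg_psi_n h lam) L z v;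
          vr = v + L *\<^sub>R (z - zh) + grad psi_s zh - grad psi_s z;
          vh = (1 / lam) *\<^sub>R (vr + z0 - zh) + grad f1 zh - grad f1 z0
      in (zh, vh))"

type_synonym 'a aicg_output = "'a \<times> 'a option \<times> bool"

datatype 'a outer_result =
    Stop "'a aicg_output"
  | Continue 'a
  | Inner_Diverges

text \<open>One outer iteration from the prox center \<open>z\<close>; \<open>z0\<close> is the initial point of the method.\<close>

definition aicg_outer ::
  "('a::euclidean_space \<Rightarrow> real) \<Rightarrow> ('a \<Rightarrow> real) \<Rightarrow> ('a \<Rightarrow> ereal) \<Rightarrow> real \<Rightarrow> real \<Rightarrow> real \<Rightarrow> real
     \<Rightarrow> 'a \<Rightarrow> 'a \<Rightarrow> 'a outer_result" where
  "aicg_outer f1 f2 h M2 rho lam theta z0 z =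
     (let psi_s = aicg_psi_s f1 f2 lam z;
          psi_n = aicg_psi_n h lam
      in case sacg psi_s psi_n z theta 1 (aicg_L lam M2) of
           None \<Rightarrow> Inner_Diverges
         | Some (zk, Some vk, epsk, True) \<Rightarrow>
             (if Delta psi_s psi_n 1 z zk vk > epsk then Stop (z0, None, False)
              else (let (zh, vh) = sref f1 f2 h lam M2 zk z vk
                    in if norm vh \<le> rho then Stop (zh, Some vh, True) else Continue zk))
         | Some _ \<Rightarrow> Stop (z0, None, False))"

text \<open>The iterate $z_k$, or \<open>None\<close> if the method does not get past its \<open>k\<close>-th outer iteration.\<close>

primrec aicg_iter ::
  "('a::euclidean_space \<Rightarrow> real) \<Rightarrow> ('a \<Rightarrow> real) \<Rightarrow> ('a \<Rightarrow> ereal) \<Rightarrow> real \<Rightarrow> real \<Rightarrow> real \<Rightarrow> real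
     \<Rightarrow> 'a \<Rightarrow> nat \<Rightarrow> 'a option" where
  "aicg_iter f1 f2 h M2 rho lam theta z0 0 = Some z0"
| "aicg_iter f1 f2 h M2 rho lam theta z0 (Suc k) =
     (case aicg_iter f1 f2 h M2 rho lam theta z0 k of
        None \<Rightarrow> None
      | Some z \<Rightarrow> (case aicg_outer f1 f2 h M2 rho lam theta z0 z of
                     Continue z' \<Rightarrow> Some z'
                   | _ \<Rightarrow> None))"

text \<open>The method stops in its \<open>N\<close>-th outer iteration with output \<open>res\<close>.\<close>

definition aicg_stops ::
  "('a::euclidean_space \<Rightarrow> real) \<Rightarrow> ('a \<Rightarrow> real) \<Rightarrow> ('a \<Rightarrow> ereal) \<Rightarrow> real \<Rightarrow> real \<Rightarrow> real \<Rightarrow> real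
     \<Rightarrow> 'a \<Rightarrow> nat \<Rightarrow> 'a aicg_output \<Rightarrow> bool" where
  "aicg_stops f1 f2 h M2 rho lam theta z0 N res \<longleftrightarrow>
     (\<exists>k z. N = Suc k \<and> aicg_iter f1 f2 h M2 rho lam theta z0 k = Some z \<and>
            aicg_outer f1 f2 h M2 rho lam theta z0 z = Stop res)"

definition aicg_search_points ::
  "('a::euclidean_space \<Rightarrow> real) \<Rightarrow> ('a \<Rightarrow> real) \<Rightarrow> ('a \<Rightarrow> ereal) \<Rightarrow> real \<Rightarrow> real \<Rightarrow> real \<Rightarrow> real
     \<Rightarrow> 'a \<Rightarrow> 'a set" where
  "aicg_search_points f1 f2 h M2 rho lam theta z0 =
     (\<Union>z \<in> {z. \<exists>k. aicg_iter f1 f2 h M2 rho lam theta z0 k = Some z}.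
        sacg_search_points (aicg_psi_s f1 f2 lam z) (aicg_psi_n h lam) z theta 1 (aicg_L lam M2))"

section \<open>Conditions for the termination and convexity claims\<close>

text \<open>If \<open>Z\<close> has nonempty interior, then membership in the class $\mathcal C_{m,M}(Z)$ makes
  the gradient Lipschitz continuous on \<open>Z\<close> with constant \<open>curv_max m M\<close>. If \<open>Z\<close> is contained in
  a hyperplane, the class says nothing about how the component of the gradient normal to \<open>Z\<close> varies.
  For instance, \<open>f (x, y) = K * x * y\<close> satisfies the inequalities with \<open>m = M = 0\<close> on the segment
  from (0, 0) to (1, 0), for every \<open>K\<close>. The Lipschitz bound then has to be required.\<close>

definition lipschitz_gradients ::
  "'a::euclidean_space set \<Rightarrow> ('a \<Rightarrow> real) \<Rightarrow> real \<Rightarrow> ('a \<Rightarrow> real) \<Rightarrow> real \<Rightarrow> bool" where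
  "lipschitz_gradients Z f1 L1 f2 L2 \<longleftrightarrow>
     interior Z \<noteq> {} \<or> (L1-lipschitz_on Z (grad f1) \<and> L2-lipschitz_on Z (grad f2))"

text \<open>The search points $\tilde x_k$ of S.ACG are extrapolated and may lie outside \<open>Z\<close>, where
  the hypotheses on \<open>f2\<close> say nothing. Convexity and the curvature bounds are therefore required
  on a set \<open>D\<close> that contains \<open>Z\<close> and the search points actually visited; \<open>D = Z\<close> is the case
  in which they stay in \<open>Z\<close>, and \<open>D = UNIV\<close> needs no condition on them.\<close>

definition convex_along_run ::
  "'a::euclidean_space set \<Rightarrow> ('a \<Rightarrow> real) \<Rightarrow> ('a \<Rightarrow> real) \<Rightarrow> ('a \<Rightarrow> ereal) \<Rightarrow> real \<Rightarrow> real
     \<Rightarrow> real \<Rightarrow> real \<Rightarrow> real \<Rightarrow> 'a \<Rightarrow> bool" where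
  "convex_along_run Z f1 f2 h m2 M2 rho lam theta z0 \<longleftrightarrow>
     (\<exists>D. Z \<subseteq> D \<and> aicg_search_points f1 f2 h M2 rho lam theta z0 \<subseteq> D \<and>
          convex_on D f2 \<and> curv_class m2 M2 D f2)"

end

theory Submission
  imports Defs
begin

text \<open>Write $D_k = \|z_k - z_{k-1}\|$. An accepted outer iteration has
  $\|v_k\|^2 + 2\varepsilon_k \le \theta^2 D_k^2$ and $\Delta_1(z_{k-1}; z_k, v_k) \le \varepsilon_k$;
  together with the upper curvature of $f_1$ and $\lambda M_1 + \theta^2 < 1/2$ this gives
  $D_k^2 / 4 \le \lambda (\phi(z_{k-1}) - \phi(z_k))$. The refinement test forces
  $\|\hat z_k - z_k\| \le \theta D_k / \sqrt L$, hence
  $\|\hat v_k\| \le 2 D_k \lambda^{-1/2} [\sqrt\lambda L_1 + (1 + \theta \overline C_\lambda) / \sqrt\lambda]$,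
  and summing the descent over the iterations with $\|\hat v_k\| > \hat\rho$ bounds their number.
  S.ACG itself always returns, even when its search points leave \<open>Z\<close>: surviving both tests
  forever forces $\|y_k - y_0\| \to 0$, which makes the first iterate equal to $y_0$, and there the
  method returns at once. If $f_2$ is convex, the quadratics $\Gamma_k$ minorize $\psi$ on \<open>Z\<close> and the
  estimate-sequence inequality $A_k \psi(y_k) \le \min_u (A_k \Gamma_k(u) + \|u - y_0\|^2 / 2)$ shows that
  no failure test fires.\<close>

section \<open>Composite proximal steps\<close>

text \<open>The obstacle is that S.ACG evaluates \<open>grad psi_s\<close> at extrapolated points,
  where the hypotheses on \<open>Z\<close> leave \<open>f2\<close> free. Its termination therefore
  has to come from the recursion itself. When neither test fires, the two inequalities combine into
  a bound of \<open>theta^2 (1 + A_k) ||y_k - y_0||^2\<close> by a fixed multiple of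
  \<open>||x_k - y_0||^2\<close>. Here \<open>A_k\<close> grows at least like \<open>k / L\<close>,
  whereas the choice of \<open>acg_a\<close> makes the displacement of \<open>x_k\<close> depend
  only on those of the last two points \<open>y\<close>, whatever the gradients were. This is what
  forces contraction.

  The outer analysis does not meet the obstacle: its residual and descent bounds take gradients only
  at the prox center, the S.ACG output and the refined point, all of them in \<open>Z\<close>. A
  Lipschitz bound on \<open>Z\<close> is therefore enough there, and when \<open>Z\<close> has
  interior points it is derived from the two-sided curvature inequality with its sharp constant.
  Only the estimate-sequence argument needs convexity and curvature at the search points, and only
  against comparison points in \<open>Z\<close>.\<close>

lemma norm_diff_square_expand:
  fixes u p w :: "'a::real_inner"
  shows "(norm (u - w))\<^sup>2 = (norm (u - p))\<^sup>2 + 2 * ((u - p) \<bullet> (p - w)) + (norm (p - w))\<^sup>2"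
  unfolding power2_norm_eq_inner by (simp add: inner_simps inner_commute)

lemma norm_convex_comb_square_le:
  fixes p q :: "'a::real_inner"
  assumes "s \<ge> 0" "t \<ge> 0" "s + t = 1"
  shows "(norm (s *\<^sub>R p + t *\<^sub>R q))\<^sup>2 \<le> s * (norm p)\<^sup>2 + t * (norm q)\<^sup>2"
proof -
  have t: "t = 1 - s" using assms by simp
  have "s * (norm p)\<^sup>2 + t * (norm q)\<^sup>2 - (norm (s *\<^sub>R p + t *\<^sub>R q))\<^sup>2 = s * t * (norm (p - q))\<^sup>2"
    unfolding t power2_norm_eq_inner by (simp add: inner_simps inner_commute algebra_simps)
  moreover have "s * t * (norm (p - q))\<^sup>2 \<ge> 0" using assms by simp
  ultimately show ?thesis by linarith
qed

lemma conv_class_nonempty: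
  assumes "conv_class Z h" shows "Z \<noteq> {}"
  using assms unfolding conv_class_def by (elim conjE)

lemma conv_class_eq_real:
  assumes "conv_class Z h" "z \<in> Z"
  shows "h z = ereal (real_of_ereal (h z))"
proof -
  have "\<bar>h z\<bar> \<noteq> \<infinity>" using assms by (auto simp: conv_class_def)
  then show ?thesis by (simp add: ereal_real')
qed

lemma aicg_psi_n_eq_real:
  assumes "conv_class Z h" "z \<in> Z"
  shows "aicg_psi_n h lam z = ereal (lam * real_of_ereal (h z))"
proof -
  obtain r where "h z = ereal r" using conv_class_eq_real[OF assms] by blast
  then show ?thesis by (simp add: aicg_psi_n_def)
qed

lemma conv_class_eq_PInfty:
  assumes "conv_class Z h" "z \<notin> Z"
  shows "h z = \<infinity>"
proof -
  have "\<bar>h z\<bar> = \<infinity>" "h z \<noteq> - \<infinity>" using assms by (auto simp: conv_class_def)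
  then show ?thesis by auto
qed

lemma conv_class_convex_ineq:
  assumes h: "conv_class Z h" and xy: "x \<in> Z" "y \<in> Z" and t: "0 < t" "t < 1"
  shows "(1 - t) *\<^sub>R x + t *\<^sub>R y \<in> Z"
    and "real_of_ereal (h ((1 - t) *\<^sub>R x + t *\<^sub>R y))
           \<le> (1 - t) * real_of_ereal (h x) + t * real_of_ereal (h y)"
proof -
  let ?w = "(1 - t) *\<^sub>R x + t *\<^sub>R y"
  have "h ?w \<le> ereal (1 - t) * h x + ereal t * h y"
    using h t unfolding conv_class_def by blast
  also have "\<dots> = ereal ((1 - t) * real_of_ereal (h x) + t * real_of_ereal (h y))"
    using aicg_psi_n_eq_real[OF h xy(1), of "1 - t"] aicg_psi_n_eq_real[OF h xy(2), of t]
    unfolding aicg_psi_n_def by simp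
  finally have le: "h ?w \<le> ereal ((1 - t) * real_of_ereal (h x) + t * real_of_ereal (h y))" .
  then show w: "?w \<in> Z" using conv_class_eq_PInfty[OF h] by fastforce
  show "real_of_ereal (h ?w) \<le> (1 - t) * real_of_ereal (h x) + t * real_of_ereal (h y)"
    using le conv_class_eq_real[OF h w] by (metis ereal_less_eq(3))
qed

text \<open>The threshold is a continuous function rather than a number so that the smooth part of
  an objective can be moved to the right-hand side.\<close>

lemma conv_class_closed_sublevel:
  assumes h: "conv_class Z h" and c: "continuous_on UNIV c"
  shows "closed {u. h u \<le> ereal (c u)}"
proof -
  have "open {u. ereal (c u) < h u}"
  proof (subst open_subopen, safe)
    fix x assume x: "ereal (c x) < h x"
    then obtain a where a: "ereal (c x) < ereal a" "ereal a < h x"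
      using ereal_dense2 by blast
    have "h x \<le> Liminf (at x) h" using h unfolding conv_class_def by blast
    then have "eventually (\<lambda>u. ereal a < h u) (at x)" using a(2) unfolding le_Liminf_iff by blast
    \<comment> \<open>The filter \<open>at x\<close> omits \<open>x\<close> itself; the strict
      inequality at \<open>x\<close> fills the gap.\<close>
    then have 1: "eventually (\<lambda>u. ereal a < h u) (nhds x)"
      using a(2) by (auto simp: eventually_at_filter elim: eventually_mono)
    have "isCont c x" using c by (simp add: continuous_on_eq_continuous_at)
    then have "(c \<longlongrightarrow> c x) (nhds x)" by (simp add: isCont_def tendsto_at_iff_tendsto_nhds)
    then have 2: "eventually (\<lambda>u. c u < a) (nhds x)" using a(1) by (simp add: order_tendstoD(2))
    have "eventually (\<lambda>u. ereal (c u) < h u) (nhds x)"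
      using 1 2 by eventually_elim (metis ereal_less_eq(3) less_imp_le order.strict_trans1)
    then show "\<exists>T. open T \<and> x \<in> T \<and> T \<subseteq> {u. ereal (c u) < h u}"
      unfolding eventually_nhds by blast
  qed
  moreover have "{u. h u \<le> ereal (c u)} = - {u. ereal (c u) < h u}" by auto
  ultimately show ?thesis by (simp add: closed_def)
qed

text \<open>Weierstrass by the finite intersection property. \<open>Z\<close> need not be closed, so
  \<open>K \<inter> Z\<close> need not be compact; but each sublevel set \<open>S v\<close> is
  closed in the whole space and lies in \<open>Z\<close>. A finite family of them contains its best
  index, and a common point of all of them is a minimizer.\<close>

lemma conv_class_attains_min:
  assumes h: "conv_class Z h" and c: "continuous_on UNIV c" and lam: "lam > 0"
    and K: "compact K" "K \<inter> Z \<noteq> {}"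
  shows "\<exists>p\<in>K \<inter> Z. \<forall>u\<in>K \<inter> Z.
           c p + lam * real_of_ereal (h p) \<le> c u + lam * real_of_ereal (h u)"
proof -
  define F where "F u = c u + lam * real_of_ereal (h u)" for u
  define S where "S v = {u. h u \<le> ereal ((F v - c u) / lam)}" for v
  have S_iff: "u \<in> S v \<longleftrightarrow> u \<in> Z \<and> F u \<le> F v" for u v
  proof (cases "u \<in> Z")
    case True
    have "u \<in> S v \<longleftrightarrow> real_of_ereal (h u) \<le> (F v - c u) / lam"
      unfolding S_def using conv_class_eq_real[OF h True] by (metis ereal_less_eq(3) mem_Collect_eq)
    then show ?thesis using True lam by (simp add: F_def field_simps)
  next
    case False
    then show ?thesis using conv_class_eq_PInfty[OF h] by (simp add: S_def)
  qed
  have cl: "closed (S v)" for v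
    unfolding S_def using c lam by (intro conv_class_closed_sublevel[OF h] continuous_intros) auto
  have "K \<inter> (\<Inter>v\<in>K \<inter> Z. S v) \<noteq> {}"
  proof (rule compact_imp_fip_image[OF K(1) cl])
    fix I assume I: "finite I" "I \<subseteq> K \<inter> Z"
    show "K \<inter> (\<Inter>v\<in>I. S v) \<noteq> {}"
    proof (cases "I = {}")
      case True
      then show ?thesis using K by auto
    next
      case False
      then obtain w where w: "w \<in> I" "\<And>v. v \<in> I \<Longrightarrow> F w \<le> F v"
        using I(1) arg_min_if_finite[of I F] by (metis not_le_imp_less)
      then have "w \<in> K \<inter> (\<Inter>v\<in>I. S v)" using I(2) S_iff by auto
      then show ?thesis by blast
    qed
  qed
  then obtain p where p: "p \<in> K" "\<And>v. v \<in> K \<inter> Z \<Longrightarrow> p \<in> S v" by auto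
  then show ?thesis using K(2) S_iff unfolding F_def by blast
qed

text \<open>\<open>h\<close> is bounded below on the unit ball around \<open>z\<close> because it
  attains its minimum there. The segment from \<open>z\<close> to a distant \<open>u\<close> crosses
  the unit sphere at parameter \<open>1 / norm (u - z)\<close>, and convexity turns the bound at the
  crossing point into one for \<open>u\<close> that degrades linearly. Linear decay suffices, since
  a quadratic will be added.\<close>

lemma conv_class_linear_lower_bound:
  assumes h: "conv_class Z h" and z: "z \<in> Z"
  shows "\<exists>B\<ge>0. \<forall>u\<in>Z. - B * (1 + norm (u - z)) \<le> real_of_ereal (h u)"
proof -
  have "\<exists>p\<in>cball z 1 \<inter> Z. \<forall>u\<in>cball z 1 \<inter> Z.
           0 + 1 * real_of_ereal (h p) \<le> 0 + 1 * real_of_ereal (h u)"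
  proof (rule conv_class_attains_min[OF h])
    show "cball z 1 \<inter> Z \<noteq> {}" using z by (metis IntI centre_in_cball empty_iff zero_le_one)
  qed (simp_all add: continuous_on_const)
  then obtain p where p: "\<And>u. u \<in> cball z 1 \<inter> Z \<Longrightarrow> real_of_ereal (h p) \<le> real_of_ereal (h u)"
    unfolding add_0 mult_1 by blast
  define B where "B = \<bar>real_of_ereal (h p)\<bar> + \<bar>real_of_ereal (h z)\<bar>"
  have B0: "B \<ge> 0" unfolding B_def by (intro add_nonneg_nonneg abs_ge_zero)
  have "- B * (1 + norm (u - z)) \<le> real_of_ereal (h u)" if u: "u \<in> Z" for u
  proof (cases "norm (u - z) \<le> 1")
    case True
    then have "real_of_ereal (h p) \<le> real_of_ereal (h u)"
      using u by (intro p) (simp add: dist_norm norm_minus_commute)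
    then have "- B \<le> real_of_ereal (h u)" unfolding B_def by linarith
    moreover have "B * 1 \<le> B * (1 + norm (u - z))" by (rule mult_left_mono) (simp_all add: B0)
    ultimately show ?thesis by simp
  next
    case False
    define n where "n = norm (u - z)"
    have n: "n > 1" using False by (simp add: n_def)
    define t where "t = 1 / n"
    have t: "0 < t" "t < 1" using n by (simp_all add: t_def)
    let ?w = "(1 - t) *\<^sub>R z + t *\<^sub>R u"
    have "?w - z = t *\<^sub>R (u - z)" by (simp add: algebra_simps)
    then have "norm (?w - z) = t * n" using t by (metis abs_of_pos n_def norm_scaleR)
    then have "norm (?w - z) = 1" using n by (simp add: t_def)
    then have "?w \<in> cball z 1 \<inter> Z"
      using conv_class_convex_ineq(1)[OF h z u t] by (simp add: dist_norm norm_minus_commute)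
    then have "real_of_ereal (h p) \<le> (1 - t) * real_of_ereal (h z) + t * real_of_ereal (h u)"
      using p conv_class_convex_ineq(2)[OF h z u t] by fastforce
    moreover have "(1 - t) * real_of_ereal (h z) \<le> (1 - t) * \<bar>real_of_ereal (h z)\<bar>"
      using t by (intro mult_left_mono abs_ge_self) simp
    moreover have "(1 - t) * \<bar>real_of_ereal (h z)\<bar> \<le> 1 * \<bar>real_of_ereal (h z)\<bar>"
      using t by (intro mult_right_mono abs_ge_zero) simp
    ultimately have "- B \<le> t * real_of_ereal (h u)" unfolding B_def by linarith
    then have "- B * n \<le> real_of_ereal (h u)" using n by (simp add: t_def field_simps)
    then show ?thesis using B0 unfolding n_def by (simp add: algebra_simps)
  qed
  then show ?thesis using B0 by blast
qed

lemma composite_quadratic_attains_min: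
  assumes h: "conv_class Z h" and kap: "kap > 0" and lam: "lam > 0"
  shows "\<exists>p\<in>Z. \<forall>u\<in>Z. g \<bullet> p + kap / 2 * (norm (p - w))\<^sup>2 + lam * real_of_ereal (h p)
                   \<le> g \<bullet> u + kap / 2 * (norm (u - w))\<^sup>2 + lam * real_of_ereal (h u)"
proof -
  define q where "q u = g \<bullet> u + kap / 2 * (norm (u - w))\<^sup>2" for u
  have cont: "continuous_on UNIV q" unfolding q_def by (intro continuous_intros)
  obtain z where z: "z \<in> Z" using conv_class_nonempty[OF h] by blast
  obtain B where B: "B \<ge> 0" "\<And>u. u \<in> Z \<Longrightarrow> - B * (1 + norm (u - z)) \<le> real_of_ereal (h u)"
    using conv_class_linear_lower_bound[OF h z] by blast
  define g' where "g' = g + kap *\<^sub>R (z - w)"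
  have q_eq: "q u = q z + g' \<bullet> (u - z) + kap / 2 * (norm (u - z))\<^sup>2" for u
    unfolding q_def g'_def norm_diff_square_expand[of u w z]
    by (simp add: inner_simps inner_commute algebra_simps)
  \<comment> \<open>For \<open>n = norm (u - z) \<ge> 1\<close> the objective loses at most
    \<open>T * n\<close> against its value at \<open>z\<close>, using
    \<open>1 + n \<le> 2 * n\<close>. Beyond radius \<open>R\<close> the gain
    \<open>kap / 2 * n * n\<close> outweighs this loss.\<close>
  define T where "T = norm g' + 2 * lam * B + lam * \<bar>real_of_ereal (h z)\<bar>"
    define R where "R = max 1 (2 * T / kap)"
  have far: "q z + lam * real_of_ereal (h z) \<le> q u + lam * real_of_ereal (h u)"
    if u: "u \<in> Z" and "u \<notin> cball z R" for u
  proof -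
    define n where "n = norm (u - z)"
    have n: "n \<ge> 1" "2 * T / kap \<le> n"
      using that(2) by (auto simp: n_def R_def dist_norm norm_minus_commute)
    have "T * n \<le> kap / 2 * n * n" using n kap by (intro mult_right_mono) (simp_all add: field_simps)
    moreover have "T * n \<ge> norm g' * n + lam * B * (1 + n) + lam * \<bar>real_of_ereal (h z)\<bar>"
    proof -
      have "lam * B * (1 + n) \<le> lam * B * (2 * n)" using n B lam by (intro mult_left_mono) auto
      moreover have "lam * \<bar>real_of_ereal (h z)\<bar> * 1 \<le> lam * \<bar>real_of_ereal (h z)\<bar> * n"
        using n lam by (intro mult_left_mono mult_nonneg_nonneg abs_ge_zero) simp_all
      ultimately show ?thesis unfolding T_def by (simp add: algebra_simps)
    qed
    moreover have "- (norm g' * n) \<le> g' \<bullet> (u - z)"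
      using Cauchy_Schwarz_ineq2[of g' "u - z"] unfolding n_def by linarith
    moreover have "lam * (- B * (1 + n)) \<le> lam * real_of_ereal (h u)"
      using B(2)[OF u] lam unfolding n_def by (intro mult_left_mono) auto
    moreover have "lam * real_of_ereal (h z) \<le> lam * \<bar>real_of_ereal (h z)\<bar>"
      using lam by (intro mult_left_mono abs_ge_self) simp
    ultimately show ?thesis unfolding q_eq[of u] n_def[symmetric] power2_eq_square
      by (simp add: algebra_simps)
  qed
  have zK: "z \<in> cball z R \<inter> Z" using z by (simp add: R_def)
  then obtain p where p: "p \<in> cball z R \<inter> Z"
      "\<And>u. u \<in> cball z R \<inter> Z \<Longrightarrow> q p + lam * real_of_ereal (h p) \<le> q u + lam * real_of_ereal (h u)"
    using conv_class_attains_min[OF h cont lam compact_cball, of z R] by blast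
  have "q p + lam * real_of_ereal (h p) \<le> q u + lam * real_of_ereal (h u)" if "u \<in> Z" for u
    using p(2)[of u] p(2)[OF zK] far[OF that] that by fastforce
  then show ?thesis using p(1) unfolding q_def by blast
qed

text \<open>The passage to the limit \<open>t\<close> to 0 that discards the second-order term when
  optimality is tested along a segment.\<close>

lemma nonneg_of_affine_nonneg:
  fixes X Y :: real
  assumes "\<And>t. 0 < t \<Longrightarrow> t < 1 \<Longrightarrow> 0 \<le> X + t * Y"
  shows "0 \<le> X"
proof (rule ccontr)
  assume "\<not> 0 \<le> X"
  then have X: "X < 0" by simp
  define t where "t = min (1/2) (- X / (2 * (\<bar>Y\<bar> + 1)))"
  have "- X / (2 * (\<bar>Y\<bar> + 1)) > 0" using X by (intro divide_pos_pos) auto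
  then have t: "0 < t" "t < 1" by (auto simp: t_def)
  have "t * Y \<le> t * (\<bar>Y\<bar> + 1)" using t by (intro mult_left_mono) auto
  also have "\<dots> \<le> (- X / (2 * (\<bar>Y\<bar> + 1))) * (\<bar>Y\<bar> + 1)" by (intro mult_right_mono) (auto simp: t_def)
  also have "\<dots> = - X / 2"
    by (simp add: field_simps add_nonneg_eq_0_iff)
  finally show False using assms[OF t] X by linarith
qed

text \<open>Covers both subproblems of the method, the proximal step of S.ACG and the refinement.
  The second claim is Fermat's rule in subgradient form: minus the gradient of the quadratic part at
  the minimizer is a subgradient of \<open>lam\<close> times \<open>h\<close>.\<close>

lemma composite_argmin:
  assumes h: "conv_class Z h" and kap: "kap > 0" and lam: "lam > 0"
    and F: "\<And>u. F u = ereal (c + g \<bullet> u + kap / 2 * (norm (u - w))\<^sup>2) + ereal lam * h u"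
  shows "argmin F \<in> Z"
    and "u \<in> Z \<Longrightarrow> lam * real_of_ereal (h (argmin F)) - (g + kap *\<^sub>R (argmin F - w)) \<bullet> (u - argmin F)
                      \<le> lam * real_of_ereal (h u)"
proof -
  define q where "q u = c + g \<bullet> u + kap / 2 * (norm (u - w))\<^sup>2" for u
  define H where "H u = real_of_ereal (h u)" for u
  have FZ: "F u = ereal (q u + lam * H u)" if "u \<in> Z" for u
    unfolding F q_def H_def using aicg_psi_n_eq_real[OF h that, of lam] unfolding aicg_psi_n_def by simp
  have FN: "F u = \<infinity>" if "u \<notin> Z" for u
    using conv_class_eq_PInfty[OF h that] lam by (simp add: F)
  obtain p0 where p0: "p0 \<in> Z" "\<And>u. u \<in> Z \<Longrightarrow> q p0 + lam * H p0 \<le> q u + lam * H u"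
    using composite_quadratic_attains_min[OF h kap lam, of g w] unfolding q_def H_def by (force simp: add.assoc)
  then have "F p0 \<le> F u" for u
    by (cases "u \<in> Z") (simp_all add: FZ FN)
  \<comment> \<open>\<open>argmin\<close> is a choice operator, so it is a minimizer only once some
    minimizer is known to exist.\<close>
  then have "is_arg_min F (\<lambda>_. True) p0" by (simp add: is_arg_min_def not_less)
  then have am: "is_arg_min F (\<lambda>_. True) (argmin F)"
    unfolding argmin_def arg_min_def by (rule someI)
  define p where "p = argmin F"
  have min: "F p \<le> F u" for u using am unfolding is_arg_min_def p_def by (simp add: not_less)
  have pZ: "p \<in> Z"
  proof (rule ccontr)
    assume "p \<notin> Z"
    then show False using min[of p0] FN[of p] FZ[OF p0(1)] by simp
  qed
  then show "argmin F \<in> Z" by (simp add: p_def)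
  show "lam * real_of_ereal (h (argmin F)) - (g + kap *\<^sub>R (argmin F - w)) \<bullet> (u - argmin F)
                      \<le> lam * real_of_ereal (h u)" if u: "u \<in> Z"
  proof -
    \<comment> \<open>Moving from \<open>p\<close> a fraction \<open>t\<close> towards
      \<open>u\<close> changes the objective by at most \<open>t * (?X + t * ?Y)\<close>:
      \<open>?X\<close> is first order, \<open>?Y\<close> the curvature remainder.\<close>
    let ?X = "(g + kap *\<^sub>R (p - w)) \<bullet> (u - p) + lam * (H u - H p)"
    let ?Y = "kap / 2 * (norm (u - p))\<^sup>2"
    have "0 \<le> ?X + t * ?Y" if t: "0 < t" "t < 1" for t
    proof -
      let ?v = "(1 - t) *\<^sub>R p + t *\<^sub>R u"
      have v: "?v \<in> Z" using conv_class_convex_ineq(1)[OF h pZ u t] .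
      have vp: "?v - p = t *\<^sub>R (u - p)" by (simp add: algebra_simps)
      have "q ?v = q p + g \<bullet> (?v - p) + kap * ((?v - p) \<bullet> (p - w)) + kap / 2 * (norm (?v - p))\<^sup>2"
        unfolding q_def norm_diff_square_expand[of ?v w p] by (simp add: inner_simps algebra_simps)
      also have "\<dots> = q p + t * ((g + kap *\<^sub>R (p - w)) \<bullet> (u - p)) + t * (t * ?Y)"
        unfolding vp norm_scaleR power_mult_distrib
        by (simp add: inner_add_left inner_commute power2_eq_square algebra_simps
            del: scaleR_diff_right inner_diff_left inner_diff_right)
      finally have qv: "q ?v = q p + t * ((g + kap *\<^sub>R (p - w)) \<bullet> (u - p)) + t * (t * ?Y)" .
      have "H ?v \<le> (1 - t) * H p + t * H u"
        unfolding H_def using conv_class_convex_ineq(2)[OF h pZ u t] .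
      then have Hv: "lam * H ?v \<le> lam * ((1 - t) * H p + t * H u)" using lam by simp
      have "q p + lam * H p \<le> q ?v + lam * H ?v" using min[of ?v] by (simp add: FZ pZ v)
      then have "0 \<le> t * (?X + t * ?Y)" using qv Hv by (simp add: algebra_simps)
      then show ?thesis using t by (simp add: zero_le_mult_iff)
    qed
    then have "0 \<le> ?X" by (rule nonneg_of_affine_nonneg)
    then show ?thesis unfolding p_def H_def by (simp add: algebra_simps)
  qed
qed

section \<open>Gradients and curvature bounds\<close>

lemma grad_eqI:
  assumes "GDERIV f x :> D"
  shows "grad f x = D"
  unfolding grad_def
proof (rule the_equality)
  fix E assume "GDERIV f x :> E"
  then have "(\<lambda>h. h \<bullet> E) = (\<lambda>h. h \<bullet> D)"
    using assms unfolding gderiv_def by (rule has_derivative_unique)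
  then have "\<forall>h. h \<bullet> E = h \<bullet> D" by (simp add: fun_eq_iff)
  then show "E = D" by (rule vector_eq_ldot[THEN iffD1])
qed (fact assms)

lemma curv_class_gderiv:
  assumes "curv_class m M Z f" "z \<in> Z"
  shows "GDERIV f z :> grad f z"
  using assms grad_eqI unfolding curv_class_def by (metis subsetD)

lemma curv_class_nhd:
  assumes "curv_class m M Z f" "z \<in> Z"
  shows "eventually (\<lambda>u. GDERIV f u :> grad f u) (nhds z)" and "isCont (grad f) z"
proof -
  obtain U where U: "open U" "Z \<subseteq> U" "\<forall>x\<in>U. \<exists>D. GDERIV f x :> D" "continuous_on U (grad f)"
    using assms(1) unfolding curv_class_def by auto
  show "eventually (\<lambda>u. GDERIV f u :> grad f u) (nhds z)"
    using U(1-3) assms(2) grad_eqI unfolding eventually_nhds by (metis subsetD)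
  show "isCont (grad f) z"
    using U assms(2) continuous_on_eq_continuous_at by blast
qed

lemma curv_class_bounds:
  assumes "curv_class m M Z f" "u \<in> Z" "z \<in> Z"
  shows "- (m / 2) * (norm (u - z))\<^sup>2 \<le> f u - lin f z u"
    and "f u - lin f z u \<le> M / 2 * (norm (u - z))\<^sup>2"
  using assms unfolding curv_class_def by auto

lemma curv_class_abs_bound:
  assumes "curv_class m M Z f" "u \<in> Z" "z \<in> Z"
  shows "\<bar>f u - lin f z u\<bar> \<le> curv_max m M / 2 * (norm (u - z))\<^sup>2"
proof -
  let ?n = "(norm (u - z))\<^sup>2"
  have "M / 2 * ?n \<le> curv_max m M / 2 * ?n" "m / 2 * ?n \<le> curv_max m M / 2 * ?n"
    by (intro mult_right_mono; simp add: curv_max_def pos_part_def)+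
  then show ?thesis using curv_class_bounds[OF assms] by linarith
qed

lemma gderiv_directional:
  assumes "GDERIV f x :> D"
  shows "((\<lambda>t. (f (x + t *\<^sub>R d) - f x) / t) \<longlongrightarrow> D \<bullet> d) (at 0)"
proof -
  have "(f has_derivative (\<lambda>h. h \<bullet> D)) (at (x + 0 *\<^sub>R d))" using assms unfolding gderiv_def by simp
  moreover have "((\<lambda>t. x + t *\<^sub>R d) has_derivative (\<lambda>t. t *\<^sub>R d)) (at 0)"
    by (auto intro!: derivative_eq_intros)
  ultimately have "((\<lambda>t. f (x + t *\<^sub>R d)) has_derivative (\<lambda>t. (t *\<^sub>R d) \<bullet> D)) (at 0)"
    using has_derivative_compose by blast
  then have "((\<lambda>t. f (x + t *\<^sub>R d)) has_real_derivative D \<bullet> d) (at 0)"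
    unfolding has_field_derivative_def by (simp add: inner_commute mult.commute[of _ "D \<bullet> d"])
  then show ?thesis unfolding DERIV_def by simp
qed

text \<open>Convexity bounds the difference quotients towards \<open>u\<close> by
  \<open>f u - f x\<close>. \<open>D\<close> need not be open, so the quotients are controlled only
  from the right, and the limit is taken there.\<close>

lemma convex_on_above_gradient:
  assumes f: "convex_on D f" and xu: "x \<in> D" "u \<in> D" and g: "GDERIV f x :> grad f x"
  shows "lin f x u \<le> f u"
proof -
  have "((\<lambda>t. (f (x + t *\<^sub>R (u - x)) - f x) / t) \<longlongrightarrow> grad f x \<bullet> (u - x)) (at_right 0)"
    using gderiv_directional[OF g] by (rule filterlim_mono) (simp_all add: at_le)
  moreover have "eventually (\<lambda>t. (f (x + t *\<^sub>R (u - x)) - f x) / t \<le> f u - f x) (at_right (0::real))"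
    unfolding eventually_at_right_field
  proof (intro exI[of _ 1] conjI allI impI)
    fix t :: real assume t: "0 < t" "t < 1"
    have "f ((1 - t) *\<^sub>R x + t *\<^sub>R u) \<le> (1 - t) * f x + t * f u"
      using f xu t unfolding convex_on_def by auto
    moreover have "(1 - t) *\<^sub>R x + t *\<^sub>R u = x + t *\<^sub>R (u - x)" by (simp add: algebra_simps)
    ultimately show "(f (x + t *\<^sub>R (u - x)) - f x) / t \<le> f u - f x"
      using t by (simp add: field_simps)
  qed simp
  ultimately have "grad f x \<bullet> (u - x) \<le> f u - f x"
    using tendsto_upperbound trivial_limit_at_right_real by blast
  then show ?thesis unfolding lin_def by simp
qed

lemma half_sum_add_half_diff:
  fixes a b :: "'a::real_vector"
  shows "(1/2) *\<^sub>R (a + b) + (1/2) *\<^sub>R (a - b) = a"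
  by (simp add: scaleR_add_right[symmetric])

text \<open>The two-sided curvature bound, expanded around \<open>x\<close> and \<open>y\<close>, is applied at the other two
  vertices \<open>a\<close> and \<open>b\<close> of the parallelogram \<open>x a y b\<close>. Since its diagonals have equal length,
  the Lipschitz constant comes out sharp.\<close>

lemma gradient_diff_bound_in_ball:
  assumes f: "curv_class m M Z f" and xy: "x \<in> Z" "y \<in> Z"
    and ball: "cball ((1/2) *\<^sub>R (x + y)) (norm (x - y) / 2) \<subseteq> Z"
  shows "norm (grad f x - grad f y) \<le> curv_max m M * norm (x - y)"
proof (cases "grad f x = grad f y")
  case True
  then show ?thesis by (simp add: curv_max_def pos_part_def)
next
  case False
  define L where "L = curv_max m M"
  define p where "p = grad f x - grad f y"
  \<comment> \<open>The gradient difference rescaled to length \<open>norm (x - y)\<close>. The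
    points \<open>a\<close> and \<open>b\<close> are thus the ends of a diameter of the same ball as
    \<open>x\<close> and \<open>y\<close>, and \<open>p \<bullet> w\<close> equals
    \<open>norm p * norm (x - y)\<close> without loss.\<close>
  define w where "w = (norm (x - y) / norm p) *\<^sub>R p"
  have p: "norm p > 0" using False by (simp add: p_def)
  have nw: "norm w = norm (x - y)" using p by (simp add: w_def)
  define c where "c = (1/2) *\<^sub>R (x + y)"
  define a where "a = c - (1/2) *\<^sub>R w"
  define b where "b = c + (1/2) *\<^sub>R w"
  have ab: "a \<in> Z" "b \<in> Z"
    using ball nw by (auto simp: a_def b_def c_def dist_norm intro!: subsetD[OF ball])
  have "b - a = w" unfolding a_def b_def by (simp add: scaleR_add_left[symmetric])
  have sq: "(norm (a - x))\<^sup>2 + (norm (a - y))\<^sup>2 = (norm (x - y))\<^sup>2"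
           "(norm (b - x))\<^sup>2 + (norm (b - y))\<^sup>2 = (norm (x - y))\<^sup>2"
  proof -
    have "(norm (d - x))\<^sup>2 + (norm (d - y))\<^sup>2 = (norm (x - y))\<^sup>2"
      if "d = c + s *\<^sub>R w" "s\<^sup>2 = 1/4" for d and s :: real
    proof -
      have "d - x = s *\<^sub>R w - (1/2) *\<^sub>R (x - y)" "d - y = s *\<^sub>R w + (1/2) *\<^sub>R (x - y)"
        using half_sum_add_half_diff[of x y] half_sum_add_half_diff[of y x]
        unfolding that c_def by (simp_all add: algebra_simps)
      then have "(norm (d - x))\<^sup>2 + (norm (d - y))\<^sup>2
                   = 2 * (norm (s *\<^sub>R w))\<^sup>2 + 2 * (norm ((1/2) *\<^sub>R (x - y)))\<^sup>2"
        unfolding power2_norm_eq_inner by (simp add: inner_simps inner_commute)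
      also have "\<dots> = 2 * s\<^sup>2 * (norm w)\<^sup>2 + (norm (x - y))\<^sup>2 / 2"
        by (simp add: power_mult_distrib power_divide)
      finally show ?thesis by (simp add: nw that)
    qed
    from this[of a "-1/2"] this[of b "1/2"]
    show "(norm (a - x))\<^sup>2 + (norm (a - y))\<^sup>2 = (norm (x - y))\<^sup>2"
         "(norm (b - x))\<^sup>2 + (norm (b - y))\<^sup>2 = (norm (x - y))\<^sup>2"
      by (simp_all add: a_def b_def power2_eq_square)
  qed
  have "lin f y a - lin f x a \<le> L / 2 * ((norm (a - x))\<^sup>2 + (norm (a - y))\<^sup>2)"
    using curv_class_abs_bound[OF f ab(1) xy(1)] curv_class_abs_bound[OF f ab(1) xy(2)]
    unfolding L_def unfolding distrib_left by linarith
  moreover have "lin f x b - lin f y b \<le> L / 2 * ((norm (b - x))\<^sup>2 + (norm (b - y))\<^sup>2)"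
    using curv_class_abs_bound[OF f ab(2) xy(1)] curv_class_abs_bound[OF f ab(2) xy(2)]
    unfolding L_def unfolding distrib_left by linarith
  \<comment> \<open>In this combination the values of \<open>f\<close> cancel and only the gradient
    difference along \<open>b - a\<close> survives.\<close>
  moreover have "(lin f y a - lin f x a) + (lin f x b - lin f y b) = p \<bullet> (b - a)"
    unfolding lin_def p_def by (simp add: inner_simps)
  ultimately have "p \<bullet> w \<le> L * (norm (x - y))\<^sup>2"
    unfolding sq \<open>b - a = w\<close> by linarith
  moreover have "p \<bullet> w = norm (x - y) * norm p"
    using p by (simp add: w_def dot_square_norm power2_eq_square)
  ultimately have "norm (x - y) * norm p \<le> norm (x - y) * (L * norm (x - y))"
    by (simp add: power2_eq_square algebra_simps)
  moreover have "norm (x - y) > 0" using False by auto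
  ultimately show ?thesis unfolding L_def p_def by simp
qed

text \<open>The ball around the midpoint of a distant pair may leave \<open>Z\<close>, so the
  segment is cut into \<open>n\<close> equal pieces shorter than the radius of a tube inside
  \<open>Z\<close>. The bounds of the pieces are proportional to their lengths, and they sum to the
  same constant.\<close>

lemma gradient_diff_bound_interior:
  assumes Z: "convex Z" and f: "curv_class m M Z f"
    and x: "x \<in> interior Z" and y: "y \<in> interior Z"
  shows "norm (grad f x - grad f y) \<le> curv_max m M * norm (x - y)"
proof -
  obtain r1 r2 where r12: "r1 > 0" "ball x r1 \<subseteq> Z" "r2 > 0" "ball y r2 \<subseteq> Z"
    using x y unfolding mem_interior by blast
  define r where "r = min r1 r2"
  have r: "r > 0" "ball x r \<subseteq> Z" "ball y r \<subseteq> Z" using r12 by (auto simp: r_def)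
  define P where "P t = x + t *\<^sub>R (y - x)" for t :: real
  \<comment> \<open>A translation shorter than \<open>r\<close> keeps both ends of the segment in
    \<open>Z\<close>, hence by convexity the whole segment.\<close>
  have ballP: "ball (P t) r \<subseteq> Z" if t: "0 \<le> t" "t \<le> 1" for t
  proof
    fix u assume u: "u \<in> ball (P t) r"
    define v where "v = u - P t"
    have "norm v < r" using u by (simp add: v_def dist_norm norm_minus_commute)
    then have "x + v \<in> Z" "y + v \<in> Z" using r by (auto simp: dist_norm)
    then have "(1 - t) *\<^sub>R (x + v) + t *\<^sub>R (y + v) \<in> Z" using Z t by (auto simp: convex_alt)
    moreover have "(1 - t) *\<^sub>R (x + v) + t *\<^sub>R (y + v) = u"
      by (simp add: v_def P_def algebra_simps)
    ultimately show "u \<in> Z" by simp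
  qed
  obtain n :: nat where n: "norm (y - x) / r < real n"
    using reals_Archimedean2 by blast
  moreover have "0 \<le> norm (y - x) / r" using r(1) by simp
  ultimately have n: "n > 0" "norm (y - x) / r < real n" by linarith+
  define Q where "Q i = P (real i / real n)" for i
  have dQ: "Q i - Q (Suc i) = (- 1 / real n) *\<^sub>R (y - x)" for i
  proof -
    have "Q i - Q (Suc i) = (real i / real n - real (Suc i) / real n) *\<^sub>R (y - x)"
      unfolding Q_def P_def by (simp add: scaleR_left_diff_distrib)
    also have "real i / real n - real (Suc i) / real n = - 1 / real n"
      by (simp add: diff_divide_distrib[symmetric])
    finally show ?thesis .
  qed
  have nQ: "norm (Q i - Q (Suc i)) = norm (y - x) / real n" for i
    unfolding dQ by simp
  have small: "norm (y - x) / real n < r" using n r by (simp add: field_simps)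
  have step: "norm (grad f (Q i) - grad f (Q (Suc i))) \<le> curv_max m M * (norm (y - x) / real n)"
    if "i < n" for i
  proof -
    have "Q i \<in> Z" "Q (Suc i) \<in> Z"
      using that r(1) ballP[of "real i / real n"] ballP[of "real (Suc i) / real n"]
      unfolding Q_def by auto
    moreover have "cball ((1/2) *\<^sub>R (Q i + Q (Suc i))) (norm (Q i - Q (Suc i)) / 2) \<subseteq> Z"
    proof
      fix u assume u: "u \<in> cball ((1/2) *\<^sub>R (Q i + Q (Suc i))) (norm (Q i - Q (Suc i)) / 2)"
      have eq: "Q i - u = ((1/2) *\<^sub>R (Q i + Q (Suc i)) - u) + (1/2) *\<^sub>R (Q i - Q (Suc i))"
        using half_sum_add_half_diff[of "Q i" "Q (Suc i)"] by (simp add: algebra_simps)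
      have "norm (Q i - u) \<le> norm ((1/2) *\<^sub>R (Q i + Q (Suc i)) - u)
                               + norm ((1/2) *\<^sub>R (Q i - Q (Suc i)))"
        unfolding eq by (rule norm_triangle_ineq)
      also have "\<dots> \<le> norm (Q i - Q (Suc i)) / 2 + norm ((1/2) *\<^sub>R (Q i - Q (Suc i)))"
        using u by (simp add: dist_norm)
      also have "\<dots> < r" using small unfolding nQ by (simp add: nQ)
      finally have "u \<in> ball (P (real i / real n)) r" unfolding Q_def by (simp add: dist_norm)
      then show "u \<in> Z" using ballP[of "real i / real n"] that by auto
    qed
    ultimately show ?thesis using gradient_diff_bound_in_ball[OF f] nQ by metis
  qed
  have "norm (grad f (Q 0) - grad f (Q k)) \<le> real k * (curv_max m M * (norm (y - x) / real n))"
    if "k \<le> n" for k using that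
  proof (induction k)
    case (Suc k)
    have "norm (grad f (Q 0) - grad f (Q (Suc k)))
            \<le> norm (grad f (Q 0) - grad f (Q k)) + norm (grad f (Q k) - grad f (Q (Suc k)))"
      by (metis norm_triangle_sub diff_add_cancel norm_triangle_ineq add_diff_eq)
    moreover have "real (Suc k) * (curv_max m M * (norm (y - x) / real n))
        = real k * (curv_max m M * (norm (y - x) / real n)) + curv_max m M * (norm (y - x) / real n)"
      by (simp only: of_nat_Suc distrib_right)
    moreover have "norm (grad f (Q 0) - grad f (Q k)) \<le> real k * (curv_max m M * (norm (y - x) / real n))"
      using Suc by simp
    ultimately show ?case using step[of k] Suc.prems by linarith
  qed simp
  from this[of n] show ?thesis using n(1) by (simp add: Q_def P_def norm_minus_commute)
qed

text \<open>Both points are pushed slightly towards a common interior point, where the bound is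
  known, and continuity of the gradient carries it back to the boundary.\<close>

lemma curv_class_gradient_lipschitz:
  assumes Z: "convex Z" "interior Z \<noteq> {}" and f: "curv_class m M Z f"
  shows "(curv_max m M)-lipschitz_on Z (grad f)"
proof (rule lipschitz_onI)
  show "0 \<le> curv_max m M" by (simp add: curv_max_def pos_part_def)
  fix x y assume x: "x \<in> Z" and y: "y \<in> Z"
  obtain p where p: "p \<in> interior Z" using Z by blast
  have lim: "((\<lambda>t. u + t *\<^sub>R (p - u)) \<longlongrightarrow> u) (at_right 0)"
            "((\<lambda>t. grad f (u + t *\<^sub>R (p - u))) \<longlongrightarrow> grad f u) (at_right (0::real))"
    if "u \<in> Z" for u
  proof -
    have "((\<lambda>t. u + t *\<^sub>R (p - u)) \<longlongrightarrow> u + 0 *\<^sub>R (p - u)) (at_right 0)"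
      by (intro tendsto_intros)
    then show l: "((\<lambda>t. u + t *\<^sub>R (p - u)) \<longlongrightarrow> u) (at_right 0)" by simp
    show "((\<lambda>t. grad f (u + t *\<^sub>R (p - u))) \<longlongrightarrow> grad f u) (at_right (0::real))"
      using curv_class_nhd(2)[OF f that] l by (rule isCont_tendsto_compose)
  qed
  have int: "u + t *\<^sub>R (p - u) \<in> interior Z" if "u \<in> Z" "0 < t" "t < 1" for u and t :: real
  proof -
    have "u - t *\<^sub>R (u - p) \<in> interior Z"
      using that p Z(1) by (intro mem_interior_convex_shrink) auto
    then show ?thesis by (simp add: algebra_simps)
  qed
  have "norm (grad f x - grad f y) \<le> curv_max m M * norm (x - y)"
  proof (rule tendsto_le[OF trivial_limit_at_right_real])
    show "((\<lambda>t. norm (grad f (x + t *\<^sub>R (p - x)) - grad f (y + t *\<^sub>R (p - y))))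
             \<longlongrightarrow> norm (grad f x - grad f y)) (at_right (0::real))"
      using lim x y by (intro tendsto_intros)
    show "((\<lambda>t. curv_max m M * norm ((x + t *\<^sub>R (p - x)) - (y + t *\<^sub>R (p - y))))
             \<longlongrightarrow> curv_max m M * norm (x - y)) (at_right (0::real))"
      using lim x y by (intro tendsto_intros)
    show "eventually (\<lambda>t. norm (grad f (x + t *\<^sub>R (p - x)) - grad f (y + t *\<^sub>R (p - y)))
             \<le> curv_max m M * norm ((x + t *\<^sub>R (p - x)) - (y + t *\<^sub>R (p - y)))) (at_right (0::real))"
      unfolding eventually_at_right_field
      using int x y gradient_diff_bound_interior[OF Z(1) f] by (intro exI[of _ 1]) auto
  qed
  then show "dist (grad f x) (grad f y) \<le> curv_max m M * dist x y" by (simp add: dist_norm)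
qed

section \<open>The iteration of S.ACG\<close>

text \<open>\<open>acg_a\<close> is the positive root of \<open>a^2 = tau * (A + a)\<close>. The
  second claim is this equation times \<open>L\<close>; every later cancellation rests on it. The
  third yields the linear growth of \<open>A\<close>.\<close>

lemma acg_a_props:
  assumes L: "L > 0" and A: "acg_A s \<ge> 0"
  shows "acg_a 1 L s > 0"
    and "L * (acg_a 1 L s)\<^sup>2 = (1 + acg_A s) * (acg_A s + acg_a 1 L s)"
    and "1 / L \<le> acg_a 1 L s"
proof -
  define t where "t = (1 + acg_A s) / L"
  define q where "q = sqrt (t\<^sup>2 + 4 * t * acg_A s)"
  have t: "t > 0" "t \<ge> 1 / L" "L * t = 1 + acg_A s"
    using L A by (simp_all add: t_def field_simps)
  have a: "acg_a 1 L s = (t + q) / 2"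
    unfolding acg_a_def Let_def t_def q_def by simp
  have q2: "q\<^sup>2 = t\<^sup>2 + 4 * t * acg_A s" using t A by (simp add: q_def)
  have "q \<ge> t" using t A unfolding q_def by (intro real_le_rsqrt) simp
  then have "0 < q" using t(1) by (rule less_le_trans[rotated])
  then show "acg_a 1 L s > 0" using t(1) unfolding a by (simp add: add_pos_pos)
  have "t \<le> acg_a 1 L s" using \<open>q \<ge> t\<close> unfolding a by simp
  with t(2) show "1 / L \<le> acg_a 1 L s" by (rule order_trans)
  have "(acg_a 1 L s)\<^sup>2 = t * (acg_A s + acg_a 1 L s)"
    unfolding a using q2 by (simp add: power2_eq_square field_simps)
  then show "L * (acg_a 1 L s)\<^sup>2 = (1 + acg_A s) * (acg_A s + acg_a 1 L s)"
    using t(3) by (metis mult.assoc)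
qed

lemma acg_A_step: "acg_A (acg_step psi_s psi_n mu L s) = acg_A s + acg_a mu L s"
  unfolding acg_step_def Let_def by simp

lemma acg_x_step:
  "acg_x (acg_step psi_s psi_n mu L s) =
     acg_x s + (acg_a mu L s / (1 + mu * (acg_A s + acg_a mu L s))) *\<^sub>R
       (L *\<^sub>R (acg_y (acg_step psi_s psi_n mu L s) - acg_xt mu L s)
        + mu *\<^sub>R (acg_y (acg_step psi_s psi_n mu L s) - acg_x s))"
  unfolding acg_step_def Let_def by simp

lemma acg_Gamma_step:
  assumes h: "conv_class Z h" and y: "acg_y (acg_step psi_s (aicg_psi_n h lam) mu L s) = y'" "y' \<in> Z"
  shows "acg_Gamma (acg_step psi_s (aicg_psi_n h lam) mu L s) u =
     acg_A s / (acg_A s + acg_a mu L s) * acg_Gamma s u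
     + acg_a mu L s / (acg_A s + acg_a mu L s) *
        (lin psi_s (acg_xt mu L s) y' + lam * real_of_ereal (h y')
           + mu / 2 * (norm (y' - acg_xt mu L s))\<^sup>2
         + L * ((acg_xt mu L s - y') \<bullet> (u - y')) + mu / 2 * (norm (u - y'))\<^sup>2)"
  unfolding y(1)[symmetric] unfolding acg_step_def Let_def
  using aicg_psi_n_eq_real[OF h y(2), of lam] y(1) unfolding acg_step_def Let_def by simp

text \<open>The subproblem has curvature \<open>(L + 1) / L\<close>: the proximity term contributes
  1, and the \<open>mu = 1\<close> term inside \<open>q\<close> contributes \<open>1 / L\<close>.
  Scaling the optimality condition by \<open>L\<close> gives the factor
  \<open>L + 1\<close>.\<close>

lemma acg_y_step:
  fixes psi_s :: "'a::euclidean_space \<Rightarrow> real"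
  assumes h: "conv_class Z h" and lam: "lam > 0" and L: "L > 0"
    and y': "y' = acg_y (acg_step psi_s (aicg_psi_n h lam) 1 L s)"
    and xt: "xt = acg_xt 1 L s"
  shows "y' \<in> Z"
    and "u \<in> Z \<Longrightarrow> lam * real_of_ereal (h y') - (grad psi_s xt + (L + 1) *\<^sub>R (y' - xt)) \<bullet> (u - y')
                    \<le> lam * real_of_ereal (h u)"
proof -
  define q where "q u = ereal (lin psi_s xt u) + aicg_psi_n h lam u
                          + ereal (1 / 2 * (norm (u - xt))\<^sup>2)" for u
  define F where "F u = ereal (1 / L) * q u + ereal (1 / 2 * (norm (u - xt))\<^sup>2)" for u
  have y'_eq: "y' = argmin F"
    unfolding y' F_def q_def acg_step_def Let_def xt by simp
  have F: "F u = ereal ((psi_s xt - grad psi_s xt \<bullet> xt) / L + ((1 / L) *\<^sub>R grad psi_s xt) \<bullet> u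
                  + ((L + 1) / L) / 2 * (norm (u - xt))\<^sup>2) + ereal (lam / L) * h u" for u
    unfolding F_def q_def aicg_psi_n_def lin_def
    using L lam by (cases "h u") (simp_all add: inner_simps field_simps)
  have kap: "(L + 1) / L > 0" and lL: "lam / L > 0" using L lam by simp_all
  show "y' \<in> Z" unfolding y'_eq by (rule composite_argmin(1)[OF h kap lL F])
  show "lam * real_of_ereal (h y') - (grad psi_s xt + (L + 1) *\<^sub>R (y' - xt)) \<bullet> (u - y')
                    \<le> lam * real_of_ereal (h u)" if "u \<in> Z"
  proof -
    have "lam / L * real_of_ereal (h y')
            - ((1 / L) *\<^sub>R grad psi_s xt + ((L + 1) / L) *\<^sub>R (y' - xt)) \<bullet> (u - y')
          \<le> lam / L * real_of_ereal (h u)"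
      unfolding y'_eq by (rule composite_argmin(2)[OF h kap lL F that])
    moreover have "(1 / L) *\<^sub>R grad psi_s xt + ((L + 1) / L) *\<^sub>R (y' - xt)
        = (1 / L) *\<^sub>R (grad psi_s xt + (L + 1) *\<^sub>R (y' - xt))"
      by (simp add: scaleR_add_right)
    ultimately have "lam / L * real_of_ereal (h y')
            - 1 / L * ((grad psi_s xt + (L + 1) *\<^sub>R (y' - xt)) \<bullet> (u - y'))
          \<le> lam / L * real_of_ereal (h u)"
      by simp
    then have "L * (lam / L * real_of_ereal (h y')
            - 1 / L * ((grad psi_s xt + (L + 1) *\<^sub>R (y' - xt)) \<bullet> (u - y')))
          \<le> L * (lam / L * real_of_ereal (h u))"
      using L by (intro mult_left_mono) auto
    then show ?thesis using L by (simp add: right_diff_distrib)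
  qed
qed

text \<open>Each optimality inequality is tested at the other point and the two are added, which is
  monotonicity of the subdifferential. The gradient enters only through the map sending
  \<open>v\<close> to \<open>(L + 1) v - grad psi_s v\<close>, so its continuity at one point will
  suffice to compare iterates.\<close>

lemma acg_y_step_lipschitz:
  fixes psi_s :: "'a::euclidean_space \<Rightarrow> real"
  assumes h: "conv_class Z h" and lam: "lam > 0" and L: "L > 0"
    and y': "y1 = acg_y (acg_step psi_s (aicg_psi_n h lam) 1 L s1)"
            "y2 = acg_y (acg_step psi_s (aicg_psi_n h lam) 1 L s2)"
    and xt: "xt1 = acg_xt 1 L s1" "xt2 = acg_xt 1 L s2"
  shows "(L + 1) * norm (y1 - y2)
           \<le> norm (((L + 1) *\<^sub>R xt1 - grad psi_s xt1) - ((L + 1) *\<^sub>R xt2 - grad psi_s xt2))"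
proof -
  let ?b = "((L + 1) *\<^sub>R xt1 - grad psi_s xt1) - ((L + 1) *\<^sub>R xt2 - grad psi_s xt2)"
  have Z: "y1 \<in> Z" "y2 \<in> Z" using acg_y_step(1)[OF h lam L] y' by blast+
  have "(L + 1) * (norm (y1 - y2))\<^sup>2 \<le> ?b \<bullet> (y1 - y2)"
    using acg_y_step(2)[OF h lam L y'(1) xt(1) Z(2)] acg_y_step(2)[OF h lam L y'(2) xt(2) Z(1)]
    unfolding power2_norm_eq_inner by (simp add: inner_simps inner_commute algebra_simps)
  also have "\<dots> \<le> norm ?b * norm (y1 - y2)" by (rule norm_cauchy_schwarz)
  finally have "((L + 1) * norm (y1 - y2)) * norm (y1 - y2) \<le> norm ?b * norm (y1 - y2)"
    by (simp add: power2_eq_square mult.assoc)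
  then show ?thesis
    by (cases "y1 = y2") (auto simp: mult_le_cancel_right)
qed

lemma Delta_eq_real:
  assumes h: "conv_class Z h" and uz: "u \<in> Z" "z \<in> Z"
  shows "Delta psi_s (aicg_psi_n h lam) mu u z v =
    ereal ((psi_s z + lam * real_of_ereal (h z)) - (psi_s u + lam * real_of_ereal (h u))
            + (v \<bullet> (u - z) + mu / 2 * (norm (u - z))\<^sup>2))"
  unfolding Delta_def aicg_psi_n_eq_real[OF h uz(1)] aicg_psi_n_eq_real[OF h uz(2)] by simp

lemma refine_optimality:
  fixes psi_s :: "'a::euclidean_space \<Rightarrow> real"
  assumes h: "conv_class Z h" and lam: "lam > 0" and L: "L > 0"
    and zh: "zh = refine psi_s (aicg_psi_n h lam) L z v"
  shows "zh \<in> Z"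
    and "u \<in> Z \<Longrightarrow> lam * real_of_ereal (h zh) - (grad psi_s z - v + L *\<^sub>R (zh - z)) \<bullet> (u - zh)
                    \<le> lam * real_of_ereal (h u)"
proof -
  define F where "F u = ereal (lin psi_s z u - v \<bullet> u + L / 2 * (norm (u - z))\<^sup>2) + aicg_psi_n h lam u" for u
  have zh_eq: "zh = argmin F" unfolding zh refine_def F_def by simp
  have F: "F u = ereal ((psi_s z - grad psi_s z \<bullet> z) + (grad psi_s z - v) \<bullet> u + L / 2 * (norm (u - z))\<^sup>2)
                  + ereal lam * h u" for u
    unfolding F_def aicg_psi_n_def lin_def by (simp add: inner_simps algebra_simps)
  show "zh \<in> Z" unfolding zh_eq by (rule composite_argmin(1)[OF h L lam F])
  show "u \<in> Z \<Longrightarrow> lam * real_of_ereal (h zh) - (grad psi_s z - v + L *\<^sub>R (zh - z)) \<bullet> (u - zh)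
                    \<le> lam * real_of_ereal (h u)"
    unfolding zh_eq by (rule composite_argmin(2)[OF h L lam F])
qed

section \<open>Growth, displacement and termination of the S.ACG iterates\<close>

context
  fixes Z :: "'a::euclidean_space set" and h :: "'a \<Rightarrow> ereal" and psi_s :: "'a \<Rightarrow> real"
    and y0 :: 'a and lam L :: real
  assumes h: "conv_class Z h" and y0: "y0 \<in> Z" and lam: "lam > 0" and L: "L > 0"
begin

abbreviation (input) St :: "nat \<Rightarrow> 'a acg_state" where
  "St k \<equiv> acg_iter psi_s (aicg_psi_n h lam) y0 1 L k"

lemma acg_A_lower: "real k / L \<le> acg_A (St k)"
proof (induction k)
  case (Suc k)
  have "acg_A (St k) \<ge> 0" using Suc L by (meson divide_nonneg_pos of_nat_0_le_iff order_trans)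
  then have "1 / L \<le> acg_a 1 L (St k)" by (rule acg_a_props(3)[OF L])
  then show ?case using Suc by (simp add: acg_A_step add_divide_distrib)
qed simp

lemma acg_A_nonneg: "acg_A (St k) \<ge> 0"
  using acg_A_lower[of k] L by (meson divide_nonneg_pos of_nat_0_le_iff order_trans)

lemma acg_A_pos:
  assumes "k \<ge> 1" shows "acg_A (St k) > 0"
proof -
  have "real k / L > 0" using assms L by simp
  then show ?thesis using acg_A_lower[of k] by linarith
qed

lemma acg_y_mem: "acg_y (St k) \<in> Z"
  using y0 acg_y_step(1)[OF h lam L refl refl] by (cases k) auto

text \<open>In the recursion for \<open>x\<close> the coefficient of the old \<open>x\<close> is
  \<open>1 + A' - a - L * a^2 / A'\<close>, and it vanishes because
  \<open>L * a^2 = (1 + A) * A'\<close>. Hence no history beyond the last two points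
  \<open>y\<close> remains.\<close>

lemma acg_x_displacement:
  "(1 + acg_A (St (Suc k))) *\<^sub>R (acg_x (St (Suc k)) - y0)
     = (acg_a 1 L (St k) * (L + 1)) *\<^sub>R (acg_y (St (Suc k)) - y0)
       - (L * acg_a 1 L (St k) * acg_A (St k) / acg_A (St (Suc k))) *\<^sub>R (acg_y (St k) - y0)"
proof -
  define A a A' where "A = acg_A (St k)" "a = acg_a 1 L (St k)" "A' = acg_A (St (Suc k))"
  define X Y Y' where "X = acg_x (St k) - y0" "Y = acg_y (St k) - y0" "Y' = acg_y (St (Suc k)) - y0"
  note defs = A_a_A'_def X_Y_Y'_def
  have A: "A \<ge> 0" and a: "a > 0" and La: "L * a\<^sup>2 = (1 + A) * (A + a)"
    using acg_A_nonneg acg_a_props[OF L acg_A_nonneg] unfolding defs by auto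
  have A': "A' = A + a" unfolding defs by (simp add: acg_A_step)
  have A'0: "A' > 0" using A a A' by simp
  have xt: "acg_xt 1 L (St k) = y0 + (A / A') *\<^sub>R Y + (a / A') *\<^sub>R X"
  proof -
    have "acg_xt 1 L (St k) = (A / A') *\<^sub>R (Y + y0) + (a / A') *\<^sub>R (X + y0)"
      unfolding acg_xt_def Let_def A' defs by simp
    also have "\<dots> = (A / A' + a / A') *\<^sub>R y0 + (A / A') *\<^sub>R Y + (a / A') *\<^sub>R X"
      by (simp add: algebra_simps)
    also have "A / A' + a / A' = 1" using A'0 A' by (simp add: add_divide_distrib[symmetric])
    finally show ?thesis by simp
  qed
  have x': "acg_x (St (Suc k)) - y0
      = X + (a / (1 + A')) *\<^sub>R (L *\<^sub>R (Y' - ((A / A') *\<^sub>R Y + (a / A') *\<^sub>R X)) + (Y' - X))"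
    using acg_x_step[of psi_s "aicg_psi_n h lam" 1 L "St k"]
    unfolding xt using A' by (simp add: defs algebra_simps)
  have "(1 + A') *\<^sub>R (acg_x (St (Suc k)) - y0)
          = (1 + A') *\<^sub>R X + a *\<^sub>R (L *\<^sub>R (Y' - ((A / A') *\<^sub>R Y + (a / A') *\<^sub>R X)) + (Y' - X))"
    unfolding x' scaleR_add_right scaleR_scaleR using A'0 by simp
  also have "\<dots> = (1 + A' - a - L * a\<^sup>2 / A') *\<^sub>R X + (a * (L + 1)) *\<^sub>R Y' - (L * a * A / A') *\<^sub>R Y"
    by (simp add: algebra_simps power2_eq_square)
  also have "1 + A' - a - L * a\<^sup>2 / A' = 0" unfolding La A'[symmetric] using A' A'0 by simp
  finally show ?thesis unfolding defs by simp
qed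

text \<open>From \<open>a \<le> 1 + A'\<close> and \<open>A \<le> A'\<close>. The constants do not
  depend on \<open>k\<close>, which the contraction argument requires.\<close>

lemma acg_x_displacement_bound:
  "norm (acg_x (St (Suc k)) - y0)
     \<le> (L + 1) * norm (acg_y (St (Suc k)) - y0) + L * norm (acg_y (St k) - y0)"
proof -
  define A a A' where "A = acg_A (St k)" "a = acg_a 1 L (St k)" "A' = acg_A (St (Suc k))"
  have A: "A \<ge> 0" and a: "a > 0"
    using acg_A_nonneg acg_a_props[OF L acg_A_nonneg] unfolding A_a_A'_def by auto
  have A': "A' = A + a" unfolding A_a_A'_def by (simp add: acg_A_step)
  have A'0: "A' > 0" using A a A' by simp
  let ?d' = "norm (acg_y (St (Suc k)) - y0)" and ?d = "norm (acg_y (St k) - y0)"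
  have "(1 + A') * norm (acg_x (St (Suc k)) - y0) = norm ((1 + A') *\<^sub>R (acg_x (St (Suc k)) - y0))"
    using A'0 by simp
  also have "\<dots> \<le> a * (L + 1) * ?d' + L * a * A / A' * ?d"
    unfolding A_a_A'_def(3) acg_x_displacement
    unfolding A_a_A'_def[symmetric]
    by (rule norm_triangle_le_diff) (use A a A'0 L in simp)
  also have "\<dots> \<le> (1 + A') * (L + 1) * ?d' + (1 + A') * L * ?d"
  proof (intro add_mono mult_right_mono)
    have "L * a * A / A' \<le> L * a * 1"
      using A a A'0 A' L unfolding times_divide_eq_right[symmetric] by (intro mult_left_mono) auto
    also have "\<dots> \<le> (1 + A') * L" using A a A' L by (simp add: algebra_simps)
    finally show "L * a * A / A' \<le> (1 + A') * L" .
  qed (use A a A' L in auto)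
  also have "\<dots> = (1 + A') * ((L + 1) * ?d' + L * ?d)" by (simp add: algebra_simps)
  finally show ?thesis using A'0 by simp
qed

text \<open>The left-hand side is a quadratic in \<open>u\<close> with Hessian
  \<open>1 + A_k\<close> times the identity, and the update of \<open>x\<close> is exactly its
  stationarity condition. The identity is its expansion at its minimizer \<open>x_k\<close>; it is
  pure algebra.\<close>

lemma acg_Gamma_quadratic:
  "acg_A (St k) * acg_Gamma (St k) u + (norm (u - y0))\<^sup>2 / 2
     = acg_A (St k) * acg_Gamma (St k) (acg_x (St k)) + (norm (acg_x (St k) - y0))\<^sup>2 / 2
       + (1 + acg_A (St k)) / 2 * (norm (u - acg_x (St k)))\<^sup>2"
proof (induction k arbitrary: u)
  case (Suc k)
  define A a A' where "A = acg_A (St k)" "a = acg_a 1 L (St k)" "A' = acg_A (St (Suc k))"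
  define x x' y' xt where "x = acg_x (St k)" "x' = acg_x (St (Suc k))" "y' = acg_y (St (Suc k))"
    "xt = acg_xt 1 L (St k)"
  define G G' where "G = acg_Gamma (St k)" "G' = acg_Gamma (St (Suc k))"
  note defs = A_a_A'_def x_x'_y'_xt_def G_G'_def
  have A: "A \<ge> 0" and a: "a > 0"
    using acg_A_nonneg acg_a_props[OF L acg_A_nonneg] unfolding defs by auto
  have A': "A' = A + a" unfolding defs by (simp add: acg_A_step)
  have A'0: "A' > 0" using A a A' by simp
  define c where "c = lin psi_s xt y' + lam * real_of_ereal (h y') + 1 / 2 * (norm (y' - xt))\<^sup>2"
  define g where "g u = c + L * ((xt - y') \<bullet> (u - y')) + 1 / 2 * (norm (u - y'))\<^sup>2" for u
  have G': "A' * G' u = A * G u + a * g u" for u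
  proof -
    have "G' u = A / A' * G u + a / A' * g u"
      using acg_Gamma_step[OF h refl, of psi_s lam 1 L "St k" u] acg_y_mem[of "Suc k"]
      unfolding g_def c_def A' unfolding defs by simp
    then show ?thesis using A'0 by (simp add: distrib_left)
  qed
  have IH: "A * G u + (norm (u - y0))\<^sup>2 / 2 = A * G x + (norm (x - y0))\<^sup>2 / 2 + (1 + A) / 2 * (norm (u - x))\<^sup>2"
    for u using Suc.IH[of u] unfolding defs .
  have x': "x' - x = (a / (1 + A')) *\<^sub>R (L *\<^sub>R (y' - xt) + (y' - x))"
    using acg_x_step[of psi_s "aicg_psi_n h lam" 1 L "St k"] unfolding A' unfolding defs by simp
  have "(1 + A') *\<^sub>R (x' - x) = a *\<^sub>R (L *\<^sub>R (y' - xt) + (y' - x))"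
    unfolding x' using A'0 by simp
  \<comment> \<open>Stationarity at \<open>x'\<close> of the old quadratic plus \<open>a\<close>
    times the new model; it removes the linear term from the expansion below.\<close>
  then have zero: "(1 + A) *\<^sub>R (x' - x) + a *\<^sub>R (L *\<^sub>R (xt - y') + (x' - y')) = 0"
    unfolding A' by (simp add: algebra_simps)
  have lin0: "(1 + A) * ((u - x') \<bullet> (x' - x)) + a * (L * ((xt - y') \<bullet> (u - x')) + (u - x') \<bullet> (x' - y')) = 0"
    for u
  proof -
    have "(1 + A) * ((u - x') \<bullet> (x' - x)) + a * (L * ((xt - y') \<bullet> (u - x')) + (u - x') \<bullet> (x' - y'))
        = (u - x') \<bullet> ((1 + A) *\<^sub>R (x' - x) + a *\<^sub>R (L *\<^sub>R (xt - y') + (x' - y')))"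
      by (simp add: inner_add_right inner_commute[of "xt - y'"])
    then show ?thesis unfolding zero by simp
  qed
  have gu: "g u = g x' + L * ((xt - y') \<bullet> (u - x')) + (u - x') \<bullet> (x' - y') + 1 / 2 * (norm (u - x'))\<^sup>2"
    unfolding g_def norm_diff_square_expand[of u y' x'] by (simp add: inner_diff_right algebra_simps)
  have "A' * G' u + (norm (u - y0))\<^sup>2 / 2
      = (A * G x + (norm (x - y0))\<^sup>2 / 2 + (1 + A) / 2 * (norm (u - x))\<^sup>2) + a * g u"
    using G'[of u] IH[of u] by simp
  also have "\<dots> = (A * G x + (norm (x - y0))\<^sup>2 / 2 + (1 + A) / 2 * (norm (x' - x))\<^sup>2) + a * g x'
      + ((1 + A) * ((u - x') \<bullet> (x' - x)) + a * (L * ((xt - y') \<bullet> (u - x')) + (u - x') \<bullet> (x' - y')))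
      + (1 + A + a) / 2 * (norm (u - x'))\<^sup>2"
    unfolding gu norm_diff_square_expand[of u x x'] by (simp add: field_simps)
  also have "\<dots> = A' * G' x' + (norm (x' - y0))\<^sup>2 / 2 + (1 + A') / 2 * (norm (u - x'))\<^sup>2"
    unfolding lin0 using G'[of x'] IH[of x'] A' by (simp add: algebra_simps)
  finally show ?case unfolding defs .
qed simp

text \<open>Identifies \<open>r_k\<close> as the gradient of \<open>Gamma_k\<close> at
  \<open>x_k\<close>, by dividing the preceding identity by \<open>A_k\<close>, which is positive
  only from \<open>k = 1\<close> on.\<close>

lemma acg_Gamma_expand:
  assumes "k \<ge> 1"
  shows "acg_Gamma (St k) u = acg_Gamma (St k) (acg_x (St k))
     + ((1 / acg_A (St k)) *\<^sub>R (y0 - acg_x (St k))) \<bullet> (u - acg_x (St k))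
     + 1 / 2 * (norm (u - acg_x (St k)))\<^sup>2"
proof -
  define A where "A = acg_A (St k)"
  define x where "x = acg_x (St k)"
  define G where "G = acg_Gamma (St k)"
  have A: "A > 0" using acg_A_pos[OF assms] by (simp add: A_def)
  have "A * G u + (norm (u - y0))\<^sup>2 / 2
      = A * G x + (norm (x - y0))\<^sup>2 / 2 + (1 + A) / 2 * (norm (u - x))\<^sup>2"
    using acg_Gamma_quadratic[of k u] unfolding A_def x_def G_def .
  moreover have ux: "(u - x) \<bullet> (x - y0) = - ((y0 - x) \<bullet> (u - x))"
    by (simp add: inner_diff_left inner_diff_right inner_commute)
  ultimately have "A * G u = A * G x + (y0 - x) \<bullet> (u - x) + A / 2 * (norm (u - x))\<^sup>2"
    unfolding norm_diff_square_expand[of u y0 x] ux by (simp add: field_simps)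
  also have "\<dots> = A * (G x + ((1 / A) *\<^sub>R (y0 - x)) \<bullet> (u - x) + 1 / 2 * (norm (u - x))\<^sup>2)"
    using A by (simp add: distrib_left)
  finally have "G u = G x + ((1 / A) *\<^sub>R (y0 - x)) \<bullet> (u - x) + 1 / 2 * (norm (u - x))\<^sup>2"
    using A by simp
  then show ?thesis unfolding A_def x_def G_def .
qed

text \<open>If neither test fires, the residual \<open>etat\<close> can be eliminated between the two inequalities,
  whatever its sign.\<close>

lemma sacg_return_None_displacement:
  assumes k: "k \<ge> 1" and none: "sacg_return psi_s (aicg_psi_n h lam) y0 theta 1 L k = None"
  shows "theta\<^sup>2 * (1 + acg_A (St k)) * (norm (acg_y (St k) - y0))\<^sup>2
           < ((1 + 1 / acg_A (St k)) * norm (acg_x (St k) - y0))\<^sup>2"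
proof -
  define A where "A = acg_A (St k)"
  define x where "x = acg_x (St k)"
  define y where "y = acg_y (St k)"
  have A: "A > 0" using acg_A_pos[OF k] by (simp add: A_def)
  define rt where "rt = (1 / A) *\<^sub>R (y0 - x) + (y - x)"
  define d where "d = y - y0"
  obtain e where e: "\<not> 1 / (1 + A) * (norm (A *\<^sub>R rt + d))\<^sup>2 + 2 * A * e > (norm d)\<^sup>2"
      "\<not> (norm rt)\<^sup>2 + 2 * e \<le> theta\<^sup>2 * (norm d)\<^sup>2"
    using none unfolding sacg_return_def Let_def A_def x_def y_def rt_def d_def
    by (auto split: if_splits simp: add_diff_eq)
  have "(norm (A *\<^sub>R rt + d))\<^sup>2 + 2 * A * (1 + A) * e \<le> (1 + A) * (norm d)\<^sup>2"
    using e(1) A by (simp add: field_simps)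
  moreover have "(norm (A *\<^sub>R rt + d))\<^sup>2 = A\<^sup>2 * (norm rt)\<^sup>2 + 2 * A * (rt \<bullet> d) + (norm d)\<^sup>2"
    unfolding power2_norm_eq_inner by (simp add: inner_simps inner_commute power2_eq_square algebra_simps)
  \<comment> \<open>The weight \<open>A * (1 + A)\<close> gives \<open>e\<close> the same
    coefficient as in the first inequality, so \<open>e\<close> cancels. What remains has a factor
    \<open>A\<close>, and behind it the square of \<open>rt - d\<close>.\<close>
  moreover have "A * (1 + A) * (theta\<^sup>2 * (norm d)\<^sup>2) < A * (1 + A) * ((norm rt)\<^sup>2 + 2 * e)"
    using e(2) A by (intro mult_strict_left_mono) auto
  ultimately have "A * ((1 + A) * (theta\<^sup>2 * (norm d)\<^sup>2)) < A * ((norm rt)\<^sup>2 - 2 * (rt \<bullet> d) + (norm d)\<^sup>2)"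
    by (simp add: algebra_simps power2_eq_square)
  then have "(1 + A) * (theta\<^sup>2 * (norm d)\<^sup>2) < (norm rt)\<^sup>2 - 2 * (rt \<bullet> d) + (norm d)\<^sup>2"
    using A by simp
  also have "\<dots> = (norm (rt - d))\<^sup>2"
    unfolding power2_norm_eq_inner by (simp add: inner_simps inner_commute)
  also have "rt - d = (1 + 1 / A) *\<^sub>R (y0 - x)"
    unfolding rt_def d_def by (simp add: algebra_simps)
  also have "norm \<dots> = (1 + 1 / A) * norm (x - y0)"
    using A by (simp add: norm_minus_commute)
  finally show ?thesis unfolding A_def x_def y_def d_def by (simp add: mult_ac)
qed

text \<open>The factor \<open>1 + A_k\<close> on the left of the displacement inequality is
  unbounded, while \<open>1 / A_k \<le> L\<close> keeps the right-hand side under control. From some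
  index on each distance to \<open>y0\<close> is thus at most half the preceding one.\<close>

lemma sacg_return_None_y_contracts:
  assumes th: "theta > 0"
    and none: "\<And>k. k \<ge> 1 \<Longrightarrow> sacg_return psi_s (aicg_psi_n h lam) y0 theta 1 L k = None"
  shows "(\<lambda>k. norm (acg_y (St k) - y0)) \<longlonglongrightarrow> 0"
proof -
  define d where "d k = norm (acg_y (St k) - y0)" for k
  \<comment> \<open>\<open>3 * L + 1\<close> exceeds the coefficient \<open>L + 1\<close> of
    \<open>d (Suc k)\<close> by \<open>2 * L\<close>, which is what turns the coefficient
    \<open>L\<close> of \<open>d k\<close> into the ratio 1/2.\<close>
  define C where "C = (1 + L) * (3 * L + 1) / theta"
  have C: "C > 0" using th L by (simp add: C_def)
  \<comment> \<open>From index \<open>N\<close> on, \<open>A\<close> at \<open>Suc k\<close> is at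
    least \<open>Suc k / L\<close> and hence above \<open>C^2\<close>.\<close>
  obtain N :: nat where N: "L * C\<^sup>2 < real N" using reals_Archimedean2 by blast
  have half: "d (Suc k) \<le> 1 / 2 * d k" if k: "k \<ge> N" for k
  proof -
    define A where "A = acg_A (St (Suc k))"
    have A: "A > 0" "real (Suc k) / L \<le> A"
      using acg_A_pos[of "Suc k"] acg_A_lower[of "Suc k"] by (simp_all add: A_def)
    have "1 / L \<le> real (Suc k) / L" using L by (intro divide_right_mono) auto
    then have AL: "1 / L \<le> A" using A(2) by linarith
    have "1 / A \<le> L" using L A(1) AL by (simp add: field_simps)
    have "C\<^sup>2 < real N / L" using N L by (simp add: field_simps)
    also have "\<dots> \<le> real (Suc k) / L" using L k by (intro divide_right_mono) auto
    finally have CA: "C\<^sup>2 \<le> 1 + A" using A(2) by linarith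
    have "(theta * C * d (Suc k))\<^sup>2 = theta\<^sup>2 * C\<^sup>2 * (d (Suc k))\<^sup>2" by (simp add: power_mult_distrib)
    also have "\<dots> \<le> theta\<^sup>2 * (1 + A) * (d (Suc k))\<^sup>2"
      using CA by (intro mult_right_mono mult_left_mono) auto
    also have "\<dots> < ((1 + 1 / A) * norm (acg_x (St (Suc k)) - y0))\<^sup>2"
      unfolding A_def d_def by (rule sacg_return_None_displacement[OF _ none]) simp_all
    finally have "theta * C * d (Suc k) < (1 + 1 / A) * norm (acg_x (St (Suc k)) - y0)"
      by (rule power_less_imp_less_base) (use A in simp)
    also have "\<dots> \<le> (1 + L) * ((L + 1) * d (Suc k) + L * d k)"
      unfolding d_def using \<open>1 / A \<le> L\<close> L by (intro mult_mono acg_x_displacement_bound) auto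
    finally have "(1 + L) * ((3 * L + 1) * d (Suc k)) < (1 + L) * ((L + 1) * d (Suc k) + L * d k)"
      using th by (simp add: C_def mult.assoc)
    then have "(3 * L + 1) * d (Suc k) < (L + 1) * d (Suc k) + L * d k"
      using L by simp
    then have "L * (2 * d (Suc k)) < L * d k" by (simp add: algebra_simps)
    then show ?thesis using L by simp
  qed
  have "summable d"
    by (rule summable_ratio_test[of "1/2" N]) (use half in \<open>simp_all add: d_def\<close>)
  then have "d \<longlonglongrightarrow> 0" by (rule summable_LIMSEQ_zero)
  then show ?thesis unfolding d_def .
qed

text \<open>Outside \<open>Z\<close> nothing is known about \<open>psi_s\<close>, so termination cannot come from convergence
  rates. An infinite run would force the iterates, and then the search points, to converge to
  \<open>y0\<close>; by continuity of the proximal step the first iterate would already be \<open>y0\<close>, and S.ACG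
  would have returned there.\<close>

lemma sacg_returns:
  assumes th: "theta > 0" and cont: "isCont (grad psi_s) y0"
  shows "\<exists>k\<ge>1. sacg_return psi_s (aicg_psi_n h lam) y0 theta 1 L k \<noteq> None"
proof (rule ccontr)
  assume "\<not> ?thesis"
  then have none: "sacg_return psi_s (aicg_psi_n h lam) y0 theta 1 L k = None" if "k \<ge> 1" for k
    using that by blast
  define d where "d k = norm (acg_y (St k) - y0)" for k
  define xt where "xt k = acg_xt 1 L (St k)" for k
  have d: "d \<longlonglongrightarrow> 0" unfolding d_def using sacg_return_None_y_contracts[OF th none] .
  have dS: "(\<lambda>k. d (Suc k)) \<longlonglongrightarrow> 0" using d by (rule LIMSEQ_Suc)
  have "(\<lambda>k. xt (Suc k) - y0) \<longlonglongrightarrow> 0"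
  proof (rule Lim_null_comparison)
    show "eventually (\<lambda>k. norm (xt (Suc k) - y0) \<le> d (Suc k) + ((L + 1) * d (Suc k) + L * d k)) sequentially"
    proof (rule always_eventually, rule allI)
      fix k
      define A a where "A = acg_A (St (Suc k))" "a = acg_a 1 L (St (Suc k))"
      define x y where "x = acg_x (St (Suc k))" "y = acg_y (St (Suc k))"
      have Aa: "A \<ge> 0" "a > 0"
        using acg_A_nonneg acg_a_props[OF L acg_A_nonneg] unfolding A_a_def by blast+
      have sum1: "A / (A + a) + a / (A + a) = 1" using Aa by (simp add: add_divide_distrib[symmetric])
      have "xt (Suc k) = (A / (A + a)) *\<^sub>R y + (a / (A + a)) *\<^sub>R x"
        unfolding xt_def acg_xt_def Let_def A_a_def x_y_def by simp
      then have "xt (Suc k) - y0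
          = (A / (A + a)) *\<^sub>R y + (a / (A + a)) *\<^sub>R x - (A / (A + a) + a / (A + a)) *\<^sub>R y0"
        unfolding sum1 by simp
      also have "\<dots> = (A / (A + a)) *\<^sub>R (y - y0) + (a / (A + a)) *\<^sub>R (x - y0)"
        by (simp add: algebra_simps)
      also have "norm \<dots> \<le> A / (A + a) * norm (y - y0) + a / (A + a) * norm (x - y0)"
        by (rule norm_triangle_le) (use Aa in simp)
      also have "\<dots> \<le> 1 * norm (y - y0) + 1 * norm (x - y0)"
        using Aa by (intro add_mono mult_right_mono) auto
      finally show "norm (xt (Suc k) - y0) \<le> d (Suc k) + ((L + 1) * d (Suc k) + L * d k)"
        using acg_x_displacement_bound[of k] unfolding d_def x_y_def by linarith
    qed
    have "(\<lambda>k. d (Suc k) + ((L + 1) * d (Suc k) + L * d k)) \<longlonglongrightarrow> 0 + ((L + 1) * 0 + L * 0)"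
      by (intro tendsto_intros d dS)
    then show "(\<lambda>k. d (Suc k) + ((L + 1) * d (Suc k) + L * d k)) \<longlonglongrightarrow> 0" by simp
  qed
  then have xtl: "(\<lambda>k. xt (Suc k)) \<longlonglongrightarrow> y0" by (simp add: LIM_zero_iff)
  have a0: "acg_a 1 L (St 0) > 0" by (rule acg_a_props(1)[OF L]) simp
  have xt0: "xt 0 = y0" using a0 unfolding xt_def acg_xt_def Let_def by simp
  \<comment> \<open>The search points tend to \<open>y0\<close>, which is also the very first search
    point. By continuity of the proximal step the later points \<open>y\<close> tend to the first
    iterate as well as to \<open>y0\<close>.\<close>
  have y1: "acg_y (St 1) = y0"
  proof -
    define b where "b v = (L + 1) *\<^sub>R v - grad psi_s v" for v
    have "(\<lambda>k. b (xt (Suc k)) - b y0) \<longlonglongrightarrow> b y0 - b y0"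
      unfolding b_def using isCont_tendsto_compose[OF cont xtl] xtl by (intro tendsto_intros)
    then have lim: "(\<lambda>k. norm (b (xt (Suc k)) - b y0)) \<longlonglongrightarrow> 0"
      by (simp add: tendsto_norm_zero)
    have "norm (acg_y (St (Suc (Suc k))) - acg_y (St 1)) \<le> norm (b (xt (Suc k)) - b y0)" for k
    proof -
      have "(L + 1) * norm (acg_y (St (Suc (Suc k))) - acg_y (St 1)) \<le> norm (b (xt (Suc k)) - b (xt 0))"
        unfolding b_def
        by (rule acg_y_step_lipschitz[OF h lam L, where ?s1.0 = "St (Suc k)" and ?s2.0 = "St 0"])
           (simp_all add: xt_def)
      moreover have "1 * norm (acg_y (St (Suc (Suc k))) - acg_y (St 1))
          \<le> (L + 1) * norm (acg_y (St (Suc (Suc k))) - acg_y (St 1))"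
        using L by (intro mult_right_mono) auto
      ultimately show ?thesis unfolding xt0 by linarith
    qed
    then have "(\<lambda>k. acg_y (St (Suc (Suc k))) - acg_y (St 1)) \<longlonglongrightarrow> 0"
      by (intro Lim_null_comparison[OF always_eventually lim] allI)
    then have "(\<lambda>k. acg_y (St (Suc (Suc k)))) \<longlonglongrightarrow> acg_y (St 1)" by (simp add: LIM_zero_iff)
    moreover have "(\<lambda>k. acg_y (St k)) \<longlonglongrightarrow> y0"
      using d unfolding d_def by (simp add: LIM_zero_iff tendsto_norm_zero_iff)
    then have "(\<lambda>k. acg_y (St (Suc (Suc k)))) \<longlonglongrightarrow> y0" by (intro LIMSEQ_Suc)
    ultimately show ?thesis by (rule LIMSEQ_unique)
  qed
  have y1': "acg_y (acg_step psi_s (aicg_psi_n h lam) 1 L (St 0)) = y0" using y1 by simp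
  have x1: "acg_x (St 1) = y0"
    using acg_x_step[of psi_s "aicg_psi_n h lam" 1 L "St 0"] xt0 y1' unfolding xt_def by simp
  have "acg_Gamma (St 1) y0 = psi_s y0 + lam * real_of_ereal (h y0)"
    using acg_Gamma_step[OF h y1' y0, of y0] xt0 a0 unfolding xt_def
    by (simp add: lin_def)
  moreover have "real_of_ereal (ereal (psi_s y0) + aicg_psi_n h lam y0)
      = psi_s y0 + lam * real_of_ereal (h y0)"
    by (simp add: aicg_psi_n_eq_real[OF h y0])
  \<comment> \<open>Here \<open>rt\<close> and \<open>etat\<close> are both zero, so the first test
    does not fire and the second holds as 0 \<le> 0. Either outcome of the \<open>Delta\<close> test
    then returns a tuple.\<close>
  ultimately have "sacg_return psi_s (aicg_psi_n h lam) y0 theta 1 L 1 \<noteq> None"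
    unfolding sacg_return_def Let_def x1 y1 by (simp del: not_None_eq)
  then show False using none[of 1] by simp
qed

section \<open>S.ACG under strong convexity\<close>

abbreviation (input) psi :: "'a \<Rightarrow> real" where
  "psi u \<equiv> psi_s u + lam * real_of_ereal (h u)"

text \<open>The curvature bounds are required at the search point alone, tested against
  \<open>Z\<close>. The points \<open>x'\<close> and \<open>w\<close> below may lie outside
  \<open>Z\<close>; this is harmless, because there only the quadratic model \<open>g\<close> is
  evaluated, never \<open>psi\<close>.\<close>

lemma acg_potential_step:
  assumes curv: "\<And>u. u \<in> Z \<Longrightarrow> lin psi_s (acg_xt 1 L (St k)) u
                     + 1 / 2 * (norm (u - acg_xt 1 L (St k)))\<^sup>2 \<le> psi_s u"
                "\<And>u. u \<in> Z \<Longrightarrow> psi_s u \<le> lin psi_s (acg_xt 1 L (St k)) u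
                     + L / 2 * (norm (u - acg_xt 1 L (St k)))\<^sup>2"
    and below: "\<And>u. u \<in> Z \<Longrightarrow> acg_A (St k) * acg_Gamma (St k) u \<le> acg_A (St k) * psi u"
    and pot: "acg_A (St k) * psi (acg_y (St k))
      \<le> acg_A (St k) * acg_Gamma (St k) (acg_x (St k)) + (norm (acg_x (St k) - y0))\<^sup>2 / 2"
  shows "u \<in> Z \<Longrightarrow> acg_A (St (Suc k)) * acg_Gamma (St (Suc k)) u \<le> acg_A (St (Suc k)) * psi u"
    and "acg_A (St (Suc k)) * psi (acg_y (St (Suc k)))
      \<le> acg_A (St (Suc k)) * acg_Gamma (St (Suc k)) (acg_x (St (Suc k)))
         + (norm (acg_x (St (Suc k)) - y0))\<^sup>2 / 2"
proof -
  define A a A' where "A = acg_A (St k)" "a = acg_a 1 L (St k)" "A' = acg_A (St (Suc k))"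
  define x x' y y' xt where "x = acg_x (St k)" "x' = acg_x (St (Suc k))"
    "y = acg_y (St k)" "y' = acg_y (St (Suc k))" "xt = acg_xt 1 L (St k)"
  define G G' where "G = acg_Gamma (St k)" "G' = acg_Gamma (St (Suc k))"
  define H where "H u = real_of_ereal (h u)" for u
  note defs = A_a_A'_def x_x'_y_y'_xt_def G_G'_def
  have A: "A \<ge> 0" and a: "a > 0" and La: "L * a\<^sup>2 = (1 + A) * (A + a)"
    using acg_A_nonneg acg_a_props[OF L acg_A_nonneg] unfolding defs by auto
  have A': "A' = A + a" unfolding defs by (simp add: acg_A_step)
  have A'0: "A' > 0" using A a A' by simp
  have yZ: "y \<in> Z" "y' \<in> Z" unfolding defs by (rule acg_y_mem)+
  define c where "c = lin psi_s xt y' + lam * H y' + 1 / 2 * (norm (y' - xt))\<^sup>2"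
  define g where "g u = c + L * ((xt - y') \<bullet> (u - y')) + 1 / 2 * (norm (u - y'))\<^sup>2" for u
  have G': "A' * G' u = A * G u + a * g u" for u
  proof -
    have "G' u = A / A' * G u + a / A' * g u"
      using acg_Gamma_step[OF h refl, of psi_s lam 1 L "St k" u] acg_y_mem[of "Suc k"]
      unfolding g_def c_def A' H_def unfolding defs by simp
    then show ?thesis using A'0 by (simp add: distrib_left)
  qed
  have g_le: "g u \<le> psi u" if u: "u \<in> Z" for u
  proof -
    have "lam * H y' - (grad psi_s xt + (L + 1) *\<^sub>R (y' - xt)) \<bullet> (u - y') \<le> lam * H u"
      unfolding H_def by (rule acg_y_step(2)[OF h lam L _ _ u]) (simp_all add: defs)
    moreover have "lin psi_s xt u + 1 / 2 * (norm (u - xt))\<^sup>2 \<le> psi_s u"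
      using curv(1)[OF u] unfolding defs .
    moreover have "lin psi_s xt u = lin psi_s xt y' + grad psi_s xt \<bullet> (u - y')"
      unfolding lin_def by (simp add: inner_diff_right)
    moreover have "(grad psi_s xt + (L + 1) *\<^sub>R (y' - xt)) \<bullet> (u - y')
        = grad psi_s xt \<bullet> (u - y') - L * ((xt - y') \<bullet> (u - y')) + (u - y') \<bullet> (y' - xt)"
      by (simp add: inner_simps inner_commute algebra_simps)
    ultimately show ?thesis
      unfolding g_def c_def norm_diff_square_expand[of u xt y'] H_def[symmetric]
      by (simp add: field_simps)
  qed
  show "acg_A (St (Suc k)) * acg_Gamma (St (Suc k)) u \<le> acg_A (St (Suc k)) * psi u" if u: "u \<in> Z"
  proof -
    have "A * G u \<le> A * psi u" using below[OF u] unfolding defs .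
    moreover have "a * g u \<le> a * psi u" using g_le[OF u] a by simp
    ultimately have "A' * G' u \<le> A * psi u + a * psi u" unfolding G' by (rule add_mono)
    then have "A' * G' u \<le> A' * psi u" unfolding A' distrib_right .
    then show ?thesis unfolding defs .
  qed
  \<comment> \<open>The search point with \<open>x'\<close> in place of \<open>x\<close>, so that
    \<open>w - xt\<close> is a multiple of \<open>x' - x\<close>. The equation for \<open>a\<close>
    then matches the curvature \<open>1 + A\<close> of the old quadratic exactly with the smoothness
    term \<open>A' * L\<close>.\<close>
  define w where "w = (A / A') *\<^sub>R y + (a / A') *\<^sub>R x'"
  have sum1: "A / A' + a / A' = 1" using A'0 A' by (simp add: add_divide_distrib[symmetric])
  have wx: "w - xt = (a / A') *\<^sub>R (x' - x)"
    unfolding w_def x_x'_y_y'_xt_def(5) acg_xt_def Let_def A_a_A'_def[symmetric] A'[symmetric]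
      x_x'_y_y'_xt_def(1,3)[symmetric] by (simp add: algebra_simps)
  have g_conv: "A' * g w \<le> A * g y + a * g x'"
  proof -
    have w1: "w - y' = (A / A') *\<^sub>R (y - y') + (a / A') *\<^sub>R (x' - y')"
    proof -
      have "w - y' = w - (A / A' + a / A') *\<^sub>R y'" unfolding sum1 by simp
      then show ?thesis unfolding w_def by (simp add: algebra_simps)
    qed
    have n2: "(norm (w - y'))\<^sup>2 \<le> A / A' * (norm (y - y'))\<^sup>2 + a / A' * (norm (x' - y'))\<^sup>2"
      unfolding w1 using sum1 A a A'0 by (intro norm_convex_comb_square_le) auto
    have "g w = (A / A' + a / A') * c + A / A' * (L * ((xt - y') \<bullet> (y - y')))
        + a / A' * (L * ((xt - y') \<bullet> (x' - y'))) + 1 / 2 * (norm (w - y'))\<^sup>2"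
      unfolding g_def w1 sum1 by (simp add: inner_add_right algebra_simps)
    also have "\<dots> \<le> A / A' * g y + a / A' * g x'"
      using n2 unfolding g_def by (simp add: algebra_simps)
    finally have "A' * g w \<le> A' * (A / A' * g y + a / A' * g x')" using A'0 by simp
    then show ?thesis using A'0 by (simp add: distrib_left)
  qed
  have quad: "(1 + A) / 2 * (norm (x' - x))\<^sup>2 = A' * (L / 2 * (norm (w - xt))\<^sup>2)"
  proof -
    have "A' * (L / 2 * (norm (w - xt))\<^sup>2) = (L * a\<^sup>2) / A' / 2 * (norm (x' - x))\<^sup>2"
      unfolding wx norm_scaleR power_mult_distrib using A'0 a
      by (simp add: power_divide power2_eq_square)
    also have "(L * a\<^sup>2) / A' = 1 + A" unfolding La A'[symmetric] using A'0 by simp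
    finally show ?thesis by simp
  qed
  \<comment> \<open>\<open>y'\<close> minimizes \<open>g\<close> plus \<open>L / 2\<close> times the
    squared distance to \<open>xt\<close>: the cross terms cancel. The minimal value dominates
    \<open>psi y'\<close> by the upper curvature bound.\<close>
  have low: "psi y' \<le> g w + L / 2 * (norm (w - xt))\<^sup>2"
  proof -
    have "g w + L / 2 * (norm (w - xt))\<^sup>2
        = c + (1 + L) / 2 * (norm (w - y'))\<^sup>2 + L / 2 * (norm (y' - xt))\<^sup>2
          + L * ((xt - y') \<bullet> (w - y') + (w - y') \<bullet> (y' - xt))"
      unfolding g_def norm_diff_square_expand[of w xt y'] by (simp add: field_simps)
    also have "(xt - y') \<bullet> (w - y') + (w - y') \<bullet> (y' - xt) = 0"
      by (simp add: inner_simps inner_commute)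
    finally have "g w + L / 2 * (norm (w - xt))\<^sup>2 \<ge> c + L / 2 * (norm (y' - xt))\<^sup>2"
      using L by simp
    moreover have "c + L / 2 * (norm (y' - xt))\<^sup>2 \<ge> psi y'"
      using curv(2)[OF yZ(2)] unfolding c_def H_def defs[symmetric]
      using zero_le_power2[of "norm (y' - xt)"] by linarith
    ultimately show ?thesis by linarith
  qed
  have "A' * psi y' \<le> A' * (g w + L / 2 * (norm (w - xt))\<^sup>2)"
    using low A'0 by simp
  also have "\<dots> \<le> A * g y + a * g x' + (1 + A) / 2 * (norm (x' - x))\<^sup>2"
    using g_conv unfolding quad by (simp add: distrib_left)
  also have "\<dots> \<le> A * psi y + a * g x' + (1 + A) / 2 * (norm (x' - x))\<^sup>2"
    using g_le[OF yZ(1)] A by (simp add: mult_left_mono)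
  also have "\<dots> \<le> (A * G x + (norm (x - y0))\<^sup>2 / 2) + a * g x' + (1 + A) / 2 * (norm (x' - x))\<^sup>2"
    using pot unfolding defs by simp
  also have "\<dots> = A' * G' x' + (norm (x' - y0))\<^sup>2 / 2"
    using acg_Gamma_quadratic[of k x'] unfolding G' unfolding defs by simp
  finally show "acg_A (St (Suc k)) * psi (acg_y (St (Suc k)))
      \<le> acg_A (St (Suc k)) * acg_Gamma (St (Suc k)) (acg_x (St (Suc k)))
         + (norm (acg_x (St (Suc k)) - y0))\<^sup>2 / 2"
    unfolding defs .
qed

lemma acg_potential:
  assumes curv: "\<And>j u. j < k \<Longrightarrow> u \<in> Z \<Longrightarrow> lin psi_s (acg_xt 1 L (St j)) u
                     + 1 / 2 * (norm (u - acg_xt 1 L (St j)))\<^sup>2 \<le> psi_s u"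
                "\<And>j u. j < k \<Longrightarrow> u \<in> Z \<Longrightarrow> psi_s u \<le> lin psi_s (acg_xt 1 L (St j)) u
                     + L / 2 * (norm (u - acg_xt 1 L (St j)))\<^sup>2"
  shows "(\<forall>u\<in>Z. acg_A (St k) * acg_Gamma (St k) u \<le> acg_A (St k) * psi u) \<and>
    acg_A (St k) * psi (acg_y (St k))
      \<le> acg_A (St k) * acg_Gamma (St k) (acg_x (St k)) + (norm (acg_x (St k) - y0))\<^sup>2 / 2"
  using assms
proof (induction k)
  case (Suc k)
  then have IH: "\<And>u. u \<in> Z \<Longrightarrow> acg_A (St k) * acg_Gamma (St k) u \<le> acg_A (St k) * psi u"
    "acg_A (St k) * psi (acg_y (St k))
      \<le> acg_A (St k) * acg_Gamma (St k) (acg_x (St k)) + (norm (acg_x (St k) - y0))\<^sup>2 / 2"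
    by simp_all
  show ?case
    using acg_potential_step[OF Suc.prems(1)[OF lessI] Suc.prems(2)[OF lessI] IH] by blast
qed simp

text \<open>Under convexity \<open>etat\<close> is \<open>psi - Gamma_k\<close> at
  \<open>y_k\<close>, and \<open>rt\<close> is the gradient of \<open>Gamma_k\<close> there. The
  minorization of \<open>psi\<close> on \<open>Z\<close> therefore says that \<open>Delta\<close> is
  at most \<open>etat\<close> at every point of \<open>Z\<close>, which settles both the test at the
  refined point and the outer test at the prox center.\<close>

lemma sacg_return_convex:
  assumes k: "k \<ge> 1"
    and curv: "\<And>j u. j < k \<Longrightarrow> u \<in> Z \<Longrightarrow> lin psi_s (acg_xt 1 L (St j)) u
                     + 1 / 2 * (norm (u - acg_xt 1 L (St j)))\<^sup>2 \<le> psi_s u"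
                "\<And>j u. j < k \<Longrightarrow> u \<in> Z \<Longrightarrow> psi_s u \<le> lin psi_s (acg_xt 1 L (St j)) u
                     + L / 2 * (norm (u - acg_xt 1 L (St j)))\<^sup>2"
    and ret: "sacg_return psi_s (aicg_psi_n h lam) y0 theta 1 L k = Some out"
  shows "\<exists>y v e. out = (y, Some v, ereal e, True) \<and> y \<in> Z \<and>
           (\<forall>u\<in>Z. Delta psi_s (aicg_psi_n h lam) 1 u y v \<le> ereal e)"
proof -
  define A where "A = acg_A (St k)"
  define x where "x = acg_x (St k)"
  define y where "y = acg_y (St k)"
  define G where "G = acg_Gamma (St k)"
  define r where "r = (1 / A) *\<^sub>R (y0 - x)"
  define rt where "rt = r + (y - x)"
  have A: "A > 0" using acg_A_pos[OF k] by (simp add: A_def)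
  have yZ: "y \<in> Z" unfolding y_def by (rule acg_y_mem)
  have pot: "\<And>u. u \<in> Z \<Longrightarrow> A * G u \<le> A * psi u"
      "A * psi y \<le> A * G x + (norm (x - y0))\<^sup>2 / 2"
    using acg_potential[of k] curv unfolding A_def G_def x_def y_def by blast+
  have Gu: "G u = G x + r \<bullet> (u - x) + 1 / 2 * (norm (u - x))\<^sup>2" for u
    using acg_Gamma_expand[OF k, of u] unfolding A_def G_def x_def r_def .
  define et where "et = psi y - G x - r \<bullet> (y - x) - 1 / 2 * (norm (y - x))\<^sup>2"
  have etG: "et = psi y - G y" unfolding et_def Gu[of y] by simp
  have psi_y: "real_of_ereal (ereal (psi_s y) + aicg_psi_n h lam y) = psi y"
    by (simp add: aicg_psi_n_eq_real[OF h yZ])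
  have Delta: "Delta psi_s (aicg_psi_n h lam) 1 u y rt \<le> ereal et" if u: "u \<in> Z" for u
  proof -
    have "G u = G y + rt \<bullet> (u - y) + 1 / 2 * (norm (u - y))\<^sup>2"
      unfolding Gu[of u] Gu[of y] rt_def norm_diff_square_expand[of u x y]
      by (simp add: inner_simps inner_commute algebra_simps)
    moreover have "G u \<le> psi u" using pot(1)[OF u] A by simp
    ultimately show ?thesis unfolding Delta_eq_real[OF h u yZ] etG by simp
  qed
  \<comment> \<open>Since \<open>A *\<^sub>R rt + y - y0\<close> equals
    \<open>(1 + A) *\<^sub>R (y - x)\<close>, the first test is the potential inequality doubled and
    rearranged.\<close>
  have test1: "1 / (1 + A) * (norm (A *\<^sub>R rt + y - y0))\<^sup>2 + 2 * A * et \<le> (norm (y - y0))\<^sup>2"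
  proof -
    have "A *\<^sub>R rt + y - y0 = (1 + A) *\<^sub>R (y - x)"
      unfolding rt_def r_def using A by (simp add: algebra_simps)
    then have "1 / (1 + A) * (norm (A *\<^sub>R rt + y - y0))\<^sup>2 = (1 + A) * (norm (y - x))\<^sup>2"
      using A by (simp add: power_mult_distrib power2_eq_square)
    moreover have "2 * A * et = 2 * (A * psi y) - 2 * (A * G x) - 2 * ((y0 - x) \<bullet> (y - x)) - A * (norm (y - x))\<^sup>2"
      unfolding et_def r_def using A by (simp add: algebra_simps)
    moreover have "(norm (y - y0))\<^sup>2 = (norm (y - x))\<^sup>2 - 2 * ((y0 - x) \<bullet> (y - x)) + (norm (x - y0))\<^sup>2"
      unfolding norm_diff_square_expand[of y y0 x] by (simp add: inner_simps inner_commute)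
    ultimately show ?thesis using pot(2) by (simp add: algebra_simps)
  qed
  have ref: "refine psi_s (aicg_psi_n h lam) L y rt \<in> Z"
    by (rule refine_optimality(1)[OF h lam L refl])
  have "sacg_return psi_s (aicg_psi_n h lam) y0 theta 1 L k =
     (if 1 / (1 + A) * (norm (A *\<^sub>R rt + y - y0))\<^sup>2 + 2 * A * et > (norm (y - y0))\<^sup>2
      then Some (y0, None, \<infinity>, False)
      else if (norm rt)\<^sup>2 + 2 * et \<le> theta\<^sup>2 * (norm (y - y0))\<^sup>2
      then (if Delta psi_s (aicg_psi_n h lam) 1 (refine psi_s (aicg_psi_n h lam) L y rt) y rt > ereal et
            then Some (y0, None, \<infinity>, False) else Some (y, Some rt, ereal et, True))
      else None)"
    unfolding sacg_return_def Let_def A_def[symmetric] x_def[symmetric] y_def[symmetric] G_def[symmetric]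
      mult_1 scaleR_one r_def[symmetric] rt_def[symmetric] psi_y et_def[symmetric] by (rule refl)
  then have "out = (y, Some rt, ereal et, True)"
    using ret test1 Delta[OF ref] by (auto simp: not_less split: if_splits)
  then show ?thesis using yZ Delta by blast
qed

end

section \<open>The static AICG method\<close>

lemma aicg_psi_s_gderiv:
  assumes "GDERIV f2 u :> D"
  shows "GDERIV (aicg_psi_s f1 f2 lam z0) u :> lam *\<^sub>R (grad f1 z0 + D) + (u - z0)"
proof -
  have "((\<lambda>u. lam * (f1 z0 + grad f1 z0 \<bullet> (u - z0) + f2 u) + 1 / 2 * ((u - z0) \<bullet> (u - z0)))
          has_derivative (\<lambda>k. k \<bullet> (lam *\<^sub>R (grad f1 z0 + D) + (u - z0)))) (at u)"
    using assms unfolding gderiv_def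
    by (auto intro!: derivative_eq_intros simp: inner_simps inner_commute algebra_simps)
  then show ?thesis
    unfolding gderiv_def aicg_psi_s_def[abs_def] lin_def power2_norm_eq_inner .
qed

text \<open>The linearized \<open>f1\<close> has no gap and the proximal term contributes exactly
  half the squared distance. This is the origin of \<open>mu = 1\<close> and of the summand 1 in
  \<open>aicg_L\<close>.\<close>

lemma aicg_psi_s_linearization_gap:
  assumes "GDERIV f2 x :> grad f2 x"
  shows "aicg_psi_s f1 f2 lam z0 u - lin (aicg_psi_s f1 f2 lam z0) x u
           = lam * (f2 u - lin f2 x u) + 1 / 2 * (norm (u - x))\<^sup>2"
  unfolding lin_def[of "aicg_psi_s f1 f2 lam z0"] grad_eqI[OF aicg_psi_s_gderiv[OF assms]]
  unfolding aicg_psi_s_def lin_def power2_norm_eq_inner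
  by (simp add: inner_simps inner_commute field_simps)

lemma aicg_psi_s_curvature_upper:
  assumes f2: "curv_class m2 M2 D f2" and D: "x \<in> D" "u \<in> D" and lam: "lam > 0"
  shows "aicg_psi_s f1 f2 lam z0 u \<le> lin (aicg_psi_s f1 f2 lam z0) x u
            + aicg_L lam M2 / 2 * (norm (u - x))\<^sup>2"
proof -
  let ?n = "(norm (u - x))\<^sup>2"
  have "f2 u - lin f2 x u \<le> M2 / 2 * ?n" by (rule curv_class_bounds(2)[OF f2 D(2,1)])
  also have "\<dots> \<le> pos_part M2 / 2 * ?n" by (intro mult_right_mono) (simp_all add: pos_part_def)
  finally have "lam * (f2 u - lin f2 x u) \<le> lam * (pos_part M2 / 2 * ?n)" using lam by simp
  then show ?thesis
    using aicg_psi_s_linearization_gap[OF curv_class_gderiv[OF f2 D(1)], of f1 lam z0 u]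
    unfolding aicg_L_def by (simp add: algebra_simps add_divide_distrib)
qed

lemma aicg_psi_s_grad_isCont:
  assumes f2: "curv_class m2 M2 Z f2" and z: "z \<in> Z"
  shows "isCont (grad (aicg_psi_s f1 f2 lam z0)) z"
proof -
  have "eventually (\<lambda>u. grad (aicg_psi_s f1 f2 lam z0) u = lam *\<^sub>R (grad f1 z0 + grad f2 u) + (u - z0)) (nhds z)"
    using curv_class_nhd(1)[OF f2 z] by eventually_elim (rule grad_eqI[OF aicg_psi_s_gderiv])
  moreover have "isCont (\<lambda>u. lam *\<^sub>R (grad f1 z0 + grad f2 u) + (u - z0)) z"
    using curv_class_nhd(2)[OF f2 z] by (intro continuous_intros)
  ultimately show ?thesis by (subst isCont_cong) auto
qed

lemma aicg_L_ge_1: "lam > 0 \<Longrightarrow> aicg_L lam M2 \<ge> 1"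
  by (simp add: aicg_L_def pos_part_def)

lemma sacg_SomeD:
  assumes "sacg psi_s psi_n y0 theta mu L = Some out"
  shows "\<exists>k\<ge>1. sacg_return psi_s psi_n y0 theta mu L k = Some out \<and>
           (\<forall>j. 1 \<le> j \<and> j < k \<longrightarrow> sacg_return psi_s psi_n y0 theta mu L j = None)"
proof -
  let ?P = "\<lambda>k. k \<ge> 1 \<and> sacg_return psi_s psi_n y0 theta mu L k \<noteq> None"
  have ex: "\<exists>k. ?P k" using assms unfolding sacg_def by (auto split: if_splits)
  have "sacg_return psi_s psi_n y0 theta mu L (LEAST k. ?P k) = Some out"
    using assms ex unfolding sacg_def by (auto split: if_splits)
  moreover have "(LEAST k. ?P k) \<ge> 1" using LeastI_ex[OF ex] by blast
  moreover have "sacg_return psi_s psi_n y0 theta mu L j = None" if "1 \<le> j" "j < (LEAST k. ?P k)" for j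
    using not_less_Least[OF that(2)] that(1) by blast
  ultimately show ?thesis by blast
qed

lemma sacg_return_TrueD:
  assumes "sacg_return psi_s psi_n y0 theta mu L k = Some (y, v, e, True)"
  shows "y = acg_y (acg_iter psi_s psi_n y0 mu L k)"
    and "\<exists>w et. v = Some w \<and> e = ereal et \<and> (norm w)\<^sup>2 + 2 * et \<le> theta\<^sup>2 * (norm (y - y0))\<^sup>2 \<and>
           Delta psi_s psi_n mu (refine psi_s psi_n L y w) y w \<le> ereal et"
  using assms unfolding sacg_return_def Let_def by (auto split: if_splits simp: not_less)

section \<open>One outer iteration: subgradient, descent and residual\<close>

context
  fixes Z :: "'a::euclidean_space set" and f1 f2 :: "'a \<Rightarrow> real" and h :: "'a \<Rightarrow> ereal"
    and m1 M1 m2 M2 L1 L2 rho lam theta :: real and z0 :: 'a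
  assumes h: "conv_class Z h" and f1: "curv_class m1 M1 Z f1" and f2: "curv_class m2 M2 Z f2"
    and L12: "L1 = curv_max m1 M1" "L2 = curv_max m2 M2"
    and rho: "rho > 0" and lam: "lam > 0" and theta: "0 < theta" "theta < 1"
    and step: "lam * M1 + theta\<^sup>2 < 1 / 2"
begin

lemma aicg_L_pos: "aicg_L lam M2 > 0"
  using aicg_L_ge_1[OF lam, of M2] by linarith

abbreviation (input) phir :: "'a \<Rightarrow> real" where
  "phir u \<equiv> f1 u + f2 u + real_of_ereal (h u)"

lemma aicg_outer_not_diverges:
  assumes z: "z \<in> Z"
  shows "aicg_outer f1 f2 h M2 rho lam theta z0 z \<noteq> Inner_Diverges"
proof -
  have "\<exists>k\<ge>1. sacg_return (aicg_psi_s f1 f2 lam z) (aicg_psi_n h lam) z theta 1 (aicg_L lam M2) k \<noteq> None"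
    by (rule sacg_returns[OF h z lam aicg_L_pos theta(1) aicg_psi_s_grad_isCont[OF f2 z]])
  then have "sacg (aicg_psi_s f1 f2 lam z) (aicg_psi_n h lam) z theta 1 (aicg_L lam M2) \<noteq> None"
    using LeastI_ex[of "\<lambda>k. k \<ge> 1 \<and> sacg_return (aicg_psi_s f1 f2 lam z) (aicg_psi_n h lam) z theta 1
        (aicg_L lam M2) k \<noteq> None"]
    unfolding sacg_def by auto
  then show ?thesis
    unfolding aicg_outer_def Let_def
    by (auto split: option.splits bool.splits prod.splits if_splits)
qed

text \<open>Continuing and stopping successfully rest on the same accepted data and differ only in
  the size of the residual, so both are treated at once.\<close>

lemma aicg_outer_accepted:
  assumes z: "z \<in> Z"
    and out: "aicg_outer f1 f2 h M2 rho lam theta z0 z = r" "r = Continue z' \<or> r = Stop (zh', w', True)"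
  shows "\<exists>zk vk e zh vh. zk \<in> Z \<and> zh \<in> Z \<and>
    (norm vk)\<^sup>2 + 2 * e \<le> theta\<^sup>2 * (norm (zk - z))\<^sup>2 \<and>
    Delta (aicg_psi_s f1 f2 lam z) (aicg_psi_n h lam) 1 zh zk vk \<le> ereal e \<and>
    Delta (aicg_psi_s f1 f2 lam z) (aicg_psi_n h lam) 1 z zk vk \<le> ereal e \<and>
    zh = refine (aicg_psi_s f1 f2 lam z) (aicg_psi_n h lam) (aicg_L lam M2) zk vk \<and>
    sref f1 f2 h lam M2 zk z vk = (zh, vh) \<and>
    r = (if norm vh \<le> rho then Stop (zh, Some vh, True) else Continue zk)"
proof -
  let ?s = "aicg_psi_s f1 f2 lam z" and ?n = "aicg_psi_n h lam" and ?L = "aicg_L lam M2"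
  obtain zk v e where sacg: "sacg ?s ?n z theta 1 ?L = Some (zk, v, e, True)"
    using out unfolding aicg_outer_def Let_def
    by (auto split: option.splits bool.splits prod.splits if_splits)
  then obtain k where ret: "sacg_return ?s ?n z theta 1 ?L k = Some (zk, v, e, True)"
    using sacg_SomeD by blast
  obtain vk et where v: "v = Some vk" "e = ereal et"
      "(norm vk)\<^sup>2 + 2 * et \<le> theta\<^sup>2 * (norm (zk - z))\<^sup>2"
      "Delta ?s ?n 1 (refine ?s ?n ?L zk vk) zk vk \<le> ereal et"
    using sacg_return_TrueD(2)[OF ret] by blast
  have zk: "zk \<in> Z"
    unfolding sacg_return_TrueD(1)[OF ret] by (rule acg_y_mem[OF h z lam aicg_L_pos])
  define zh where "zh = refine ?s ?n ?L zk vk"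
  obtain vh where sref: "sref f1 f2 h lam M2 zk z vk = (zh, vh)"
    unfolding sref_def Let_def zh_def by simp
  have "zh \<in> Z" by (rule refine_optimality(1)[OF h lam aicg_L_pos zh_def])
  moreover have "Delta ?s ?n 1 z zk vk \<le> ereal et \<and>
      r = (if norm vh \<le> rho then Stop (zh, Some vh, True) else Continue zk)"
    using out unfolding aicg_outer_def Let_def sacg v
    by (auto split: if_splits simp: not_less sref)
  ultimately show ?thesis using zk v(3,4) sref unfolding zh_def by blast
qed

text \<open>The corrections in \<open>vh\<close> are made so that, after removing the two gradients
  and scaling by \<open>lam\<close>, only minus the gradient of the refinement model at
  \<open>zh\<close> is left. Optimality of \<open>zh\<close> makes this a subgradient.\<close>

lemma sref_subgradient:
  assumes zh: "sref f1 f2 h lam M2 zk z vk = (zh, vh)"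
  shows "vh - grad f1 zh - grad f2 zh \<in> subdiff h zh"
proof -
  let ?s = "aicg_psi_s f1 f2 lam z" and ?n = "aicg_psi_n h lam"
  define L where "L = aicg_L lam M2"
  have L: "L > 0" unfolding L_def by (rule aicg_L_pos)
  have zh_eq: "zh = refine ?s ?n L zk vk"
    and vh: "vh = (1 / lam) *\<^sub>R (vk + L *\<^sub>R (zk - zh) + grad ?s zh - grad ?s zk + z - zh)
                   + grad f1 zh - grad f1 z"
    using zh unfolding sref_def Let_def L_def by auto
  have zhZ: "zh \<in> Z" by (rule refine_optimality(1)[OF h lam L zh_eq])
  have grad_zh: "grad ?s zh = lam *\<^sub>R (grad f1 z + grad f2 zh) + (zh - z)"
    by (rule grad_eqI[OF aicg_psi_s_gderiv[OF curv_class_gderiv[OF f2 zhZ]]])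
  define s where "s = vh - grad f1 zh - grad f2 zh"
  have "lam *\<^sub>R s = vk + L *\<^sub>R (zk - zh) - grad ?s zk"
    unfolding s_def vh grad_zh using lam by (simp add: algebra_simps)
  then have ls: "lam *\<^sub>R s = - (grad ?s zk - vk + L *\<^sub>R (zh - zk))" by (simp add: algebra_simps)
  have "h zh + ereal (s \<bullet> (u - zh)) \<le> h u" for u
  proof (cases "u \<in> Z")
    case True
    have "lam * real_of_ereal (h zh) + (lam *\<^sub>R s) \<bullet> (u - zh) \<le> lam * real_of_ereal (h u)"
      unfolding ls inner_minus_left using refine_optimality(2)[OF h lam L zh_eq True] by linarith
    then have "lam * (real_of_ereal (h zh) + s \<bullet> (u - zh)) \<le> lam * real_of_ereal (h u)"
      by (simp add: distrib_left)
    then have "ereal (real_of_ereal (h zh) + s \<bullet> (u - zh)) \<le> ereal (real_of_ereal (h u))"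
      using lam by simp
    then show ?thesis
      by (subst conv_class_eq_real[OF h zhZ], subst conv_class_eq_real[OF h True]) simp
  qed (simp add: conv_class_eq_PInfty[OF h])
  then show ?thesis unfolding subdiff_def s_def by simp
qed

text \<open>The proximal term and the \<open>mu\<close> term of \<open>Delta\<close> each give
  \<open>?D / 2\<close>. Young's inequality for \<open>vk\<close> and the residual test cost
  \<open>(1 + theta^2) / 2\<close> of \<open>?D\<close>, the linearization of \<open>f1\<close>
  another \<open>lam * M1 / 2\<close>. With \<open>lam * M1 + theta^2 < 1/2\<close> at least a
  quarter remains.\<close>

lemma aicg_step_descent:
  assumes z: "z \<in> Z" "zk \<in> Z"
    and res: "(norm vk)\<^sup>2 + 2 * e \<le> theta\<^sup>2 * (norm (zk - z))\<^sup>2"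
    and Del: "Delta (aicg_psi_s f1 f2 lam z) (aicg_psi_n h lam) 1 z zk vk \<le> ereal e"
  shows "(norm (zk - z))\<^sup>2 / 4 \<le> lam * (phir z - phir zk)"
proof -
  let ?D = "(norm (zk - z))\<^sup>2"
  have "(aicg_psi_s f1 f2 lam z zk + lam * real_of_ereal (h zk))
      - (aicg_psi_s f1 f2 lam z z + lam * real_of_ereal (h z))
      + (vk \<bullet> (z - zk) + 1 / 2 * ?D) \<le> e"
    using Del unfolding Delta_eq_real[OF h z] by (simp add: norm_minus_commute)
  moreover have "lam * (f1 zk - lin f1 z zk) \<le> lam * (M1 / 2 * ?D)"
    using curv_class_bounds(2)[OF f1 z(2,1)] lam by simp
  moreover have "- (vk \<bullet> (z - zk)) \<le> (norm vk)\<^sup>2 / 2 + ?D / 2"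
  proof -
    have "0 \<le> (norm (vk + (z - zk)))\<^sup>2" by simp
    also have "\<dots> = (norm vk)\<^sup>2 + 2 * (vk \<bullet> (z - zk)) + ?D"
      unfolding power2_norm_eq_inner by (simp add: inner_simps inner_commute)
    finally show ?thesis by simp
  qed
  moreover have "aicg_psi_s f1 f2 lam z z = lam * (f1 z + f2 z)"
    unfolding aicg_psi_s_def lin_def by simp
  moreover have "aicg_psi_s f1 f2 lam z zk = lam * lin f1 z zk + lam * f2 zk + ?D / 2"
    unfolding aicg_psi_s_def by (simp add: distrib_left)
  ultimately have "?D / 2 - theta\<^sup>2 * ?D / 2 - lam * (M1 / 2 * ?D) \<le> lam * (phir z - phir zk)"
    using res by (simp add: right_diff_distrib distrib_left)
  moreover have "(lam * M1 + theta\<^sup>2) * ?D \<le> 1 / 2 * ?D" using step by (intro mult_right_mono) auto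
  ultimately show ?thesis by (simp add: algebra_simps)
qed

text \<open>Optimality of \<open>zh\<close> tested at \<open>zk\<close> gains \<open>L * ?n\<close>;
  the upper curvature bound gives back half of it. The bound also shows \<open>e \<ge> 0\<close>,
  which the construction of \<open>etat\<close> does not provide by itself.\<close>

lemma refine_distance_bound:
  assumes z: "zk \<in> Z" and zh: "zh = refine (aicg_psi_s f1 f2 lam z) (aicg_psi_n h lam) (aicg_L lam M2) zk vk"
    and Del: "Delta (aicg_psi_s f1 f2 lam z) (aicg_psi_n h lam) 1 zh zk vk \<le> ereal e"
  shows "aicg_L lam M2 * (norm (zh - zk))\<^sup>2 \<le> 2 * e"
proof -
  let ?s = "aicg_psi_s f1 f2 lam z"
  define L where "L = aicg_L lam M2"
  have L: "L > 0" unfolding L_def by (rule aicg_L_pos)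
  have zhZ: "zh \<in> Z" by (rule refine_optimality(1)[OF h lam aicg_L_pos zh])
  let ?n = "(norm (zh - zk))\<^sup>2"
  have "(?s zk + lam * real_of_ereal (h zk)) - (?s zh + lam * real_of_ereal (h zh))
        + (vk \<bullet> (zh - zk) + 1 / 2 * ?n) \<le> e"
    using Del unfolding Delta_eq_real[OF h zhZ z] by simp
  moreover have "?s zh \<le> ?s zk + grad ?s zk \<bullet> (zh - zk) + L / 2 * ?n"
    using aicg_psi_s_curvature_upper[OF f2 z zhZ lam, of f1 z] unfolding lin_def L_def .
  moreover have "lam * real_of_ereal (h zh) - (grad ?s zk - vk + L *\<^sub>R (zh - zk)) \<bullet> (zk - zh)
      \<le> lam * real_of_ereal (h zk)"
    using refine_optimality(2)[OF h lam aicg_L_pos zh z] unfolding L_def .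
  moreover have "(grad ?s zk - vk + L *\<^sub>R (zh - zk)) \<bullet> (zk - zh)
      = - (grad ?s zk \<bullet> (zh - zk)) + vk \<bullet> (zh - zk) - L * ?n"
    unfolding power2_norm_eq_inner by (simp add: inner_simps inner_commute algebra_simps)
  moreover have "?n \<ge> 0" by simp
  ultimately show ?thesis unfolding L_def[symmetric] by linarith
qed

text \<open>All contributions of the refinement displacement \<open>d\<close> add up to the
  coefficient \<open>(L + lam * L1 + lam * L2) / lam\<close>, that is
  \<open>C * sqrt L / lam\<close>. Since \<open>sqrt L * d \<le> theta * D\<close>, they cost
  \<open>theta * C * D / lam\<close>; this is how \<open>C_bar\<close> arises.\<close>

lemma sref_residual_bound:
  assumes lip: "L1-lipschitz_on Z (grad f1)" "L2-lipschitz_on Z (grad f2)"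
    and z: "z \<in> Z" "zk \<in> Z" "zh \<in> Z"
    and res: "(norm vk)\<^sup>2 + 2 * e \<le> theta\<^sup>2 * (norm (zk - z))\<^sup>2"
    and Del: "Delta (aicg_psi_s f1 f2 lam z) (aicg_psi_n h lam) 1 zh zk vk \<le> ereal e"
    and zh: "zh = refine (aicg_psi_s f1 f2 lam z) (aicg_psi_n h lam) (aicg_L lam M2) zk vk"
    and vh: "sref f1 f2 h lam M2 zk z vk = (zh, vh)"
  shows "norm vh \<le> 2 * norm (zk - z) / sqrt lam
           * (sqrt lam * L1 + (1 + theta * C_bar lam M2 L1 L2) / sqrt lam)"
proof -
  let ?s = "aicg_psi_s f1 f2 lam z"
  define L where "L = aicg_L lam M2"
  have L: "L \<ge> 1" unfolding L_def by (rule aicg_L_ge_1[OF lam])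
  define D where "D = norm (zk - z)"
  define d where "d = norm (zh - zk)"
  define C where "C = C_bar lam M2 L1 L2"
  have L12_0: "L1 \<ge> 0" "L2 \<ge> 0" unfolding L12 by (simp_all add: curv_max_def pos_part_def)
  have sL: "sqrt L \<ge> 1" using L by simp
  have "C = (L + lam * L1 + lam * L2) / sqrt L"
    unfolding C_def C_bar_def L_def aicg_L_def by (simp add: algebra_simps)
  then have CL: "C * sqrt L = L + lam * L1 + lam * L2" using sL by simp
  \<comment> \<open>Lets the term \<open>theta * D\<close> coming from \<open>vk\<close> be absorbed
    into \<open>theta * C * D\<close>.\<close>
  have C1: "C \<ge> 1"
  proof -
    have "sqrt L * sqrt L \<le> C * sqrt L" using L12_0 lam L unfolding CL by simp
    then have "sqrt L \<le> C" by (rule mult_right_le_imp_le) (use sL in linarith)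
    then show ?thesis using sL by linarith
  qed
  have Ld: "L * d\<^sup>2 \<le> 2 * e"
    using refine_distance_bound[OF z(2) zh Del] unfolding L_def d_def .
  have e0: "e \<ge> 0" using Ld L by (smt (verit) mult_nonneg_nonneg zero_le_power2)
  have nv: "norm vk \<le> theta * D"
  proof (rule power2_le_imp_le)
    show "(norm vk)\<^sup>2 \<le> (theta * D)\<^sup>2" using res e0 unfolding D_def power_mult_distrib by linarith
  qed (use theta in \<open>simp add: D_def\<close>)
  have sd: "sqrt L * d \<le> theta * D"
  proof (rule power2_le_imp_le)
    have "(sqrt L * d)\<^sup>2 = L * d\<^sup>2" using L by (simp add: power_mult_distrib)
    then show "(sqrt L * d)\<^sup>2 \<le> (theta * D)\<^sup>2"
      using res Ld unfolding D_def power_mult_distrib by (smt (verit) zero_le_power2)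
  qed (use theta in \<open>simp add: D_def\<close>)
  have "vh = (1 / lam) *\<^sub>R (vk + L *\<^sub>R (zk - zh) + grad ?s zh - grad ?s zk + z - zh)
                   + grad f1 zh - grad f1 z"
    using vh unfolding sref_def Let_def L_def by auto
  also have "vk + L *\<^sub>R (zk - zh) + grad ?s zh - grad ?s zk + z - zh
      = vk + L *\<^sub>R (zk - zh) + lam *\<^sub>R (grad f2 zh - grad f2 zk) + (z - zk)"
    unfolding grad_eqI[OF aicg_psi_s_gderiv[OF curv_class_gderiv[OF f2 z(3)]]]
      grad_eqI[OF aicg_psi_s_gderiv[OF curv_class_gderiv[OF f2 z(2)]]]
    by (simp add: algebra_simps)
  finally have vh_eq: "vh = (1 / lam) *\<^sub>R (vk + L *\<^sub>R (zk - zh) + lam *\<^sub>R (grad f2 zh - grad f2 zk) + (z - zk))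
                   + (grad f1 zh - grad f1 z)" by simp
  have n1: "norm (vk + L *\<^sub>R (zk - zh) + lam *\<^sub>R (grad f2 zh - grad f2 zk) + (z - zk))
      \<le> theta * D + L * d + lam * (L2 * d) + D"
  proof (intro norm_triangle_mono)
    show "norm (lam *\<^sub>R (grad f2 zh - grad f2 zk)) \<le> lam * (L2 * d)"
      using lipschitz_onD[OF lip(2) z(3) z(2)] lam by (simp add: dist_norm d_def)
  qed (use nv L in \<open>simp_all add: d_def D_def norm_minus_commute\<close>)
  have "norm (zh - z) \<le> d + D"
    unfolding d_def D_def using norm_triangle_ineq[of "zh - zk" "zk - z"] by simp
  then have n2: "norm (grad f1 zh - grad f1 z) \<le> L1 * (d + D)"
    using lipschitz_onD[OF lip(1) z(3) z(1)] L12_0(1)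
    by (metis dist_norm mult_left_mono order_trans)
  have "norm vh \<le> (1 / lam) * (theta * D + L * d + lam * (L2 * d) + D) + L1 * (d + D)"
    unfolding vh_eq
  proof (rule norm_triangle_mono[OF _ n2])
    show "norm ((1 / lam) *\<^sub>R (vk + L *\<^sub>R (zk - zh) + lam *\<^sub>R (grad f2 zh - grad f2 zk) + (z - zk)))
        \<le> (1 / lam) * (theta * D + L * d + lam * (L2 * d) + D)"
      unfolding norm_scaleR using lam n1 by (simp add: divide_right_mono)
  qed
  also have "\<dots> = L1 * D + (1 / lam) * (theta * D + D + (C * sqrt L) * d)"
    unfolding CL using lam by (simp add: field_simps)
  also have "\<dots> \<le> L1 * D + (1 / lam) * (theta * C * D + D + theta * C * D)"
  proof (intro add_left_mono mult_left_mono add_mono)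
    show "theta * D \<le> theta * C * D" using C1 theta by (simp add: D_def mult_right_mono)
    show "C * sqrt L * d \<le> theta * C * D"
      using mult_left_mono[OF sd, of C] C1 by (simp add: mult_ac)
  qed (use lam in auto)
  \<comment> \<open>The term \<open>theta * C * D\<close> occurs twice; the other terms are doubled
    too, so that a common factor 2 splits off.\<close>
  also have "\<dots> \<le> 2 * (L1 * D) + (1 / lam) * (2 * (D + theta * C * D))"
    using L12_0 lam by (intro add_mono mult_left_mono) (simp_all add: D_def)
  also have "\<dots> = 2 * D / sqrt lam * (sqrt lam * L1 + (1 + theta * C) / sqrt lam)"
  proof -
    have "2 * (L1 * D) + (1 / (S * S)) * (2 * (D + theta * C * D))
        = 2 * D / S * (S * L1 + (1 + theta * C) / S)" if "S > 0" for S
      using that by (simp add: field_simps)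
    from this[of "sqrt lam"] show ?thesis using lam by simp
  qed
  finally show ?thesis unfolding D_def C_def .
qed

lemma aicg_outer_Continue_mem:
  assumes z: "z \<in> Z" and out: "aicg_outer f1 f2 h M2 rho lam theta z0 z = Continue z'"
  shows "z' \<in> Z"
  using aicg_outer_accepted[OF z out disjI1[OF refl]] by (auto split: if_splits)

text \<open>The factor 16 is 4 from squaring the residual bound times 4 from the descent
  estimate.\<close>

lemma aicg_outer_Continue:
  assumes lip: "L1-lipschitz_on Z (grad f1)" "L2-lipschitz_on Z (grad f2)"
    and z: "z \<in> Z" and out: "aicg_outer f1 f2 h M2 rho lam theta z0 z = Continue z'"
  shows "rho\<^sup>2 \<le> 16 * (sqrt lam * L1 + (1 + theta * C_bar lam M2 L1 L2) / sqrt lam)\<^sup>2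
                   * (phir z - phir z')"
proof -
  define K where "K = sqrt lam * L1 + (1 + theta * C_bar lam M2 L1 L2) / sqrt lam"
  obtain zk vk e zh vh where s: "zk \<in> Z" "zh \<in> Z"
    "(norm vk)\<^sup>2 + 2 * e \<le> theta\<^sup>2 * (norm (zk - z))\<^sup>2"
    "Delta (aicg_psi_s f1 f2 lam z) (aicg_psi_n h lam) 1 zh zk vk \<le> ereal e"
    "Delta (aicg_psi_s f1 f2 lam z) (aicg_psi_n h lam) 1 z zk vk \<le> ereal e"
    "zh = refine (aicg_psi_s f1 f2 lam z) (aicg_psi_n h lam) (aicg_L lam M2) zk vk"
    "sref f1 f2 h lam M2 zk z vk = (zh, vh)"
    "Continue z' = (if norm vh \<le> rho then Stop (zh, Some vh, True) else Continue zk)"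
    using aicg_outer_accepted[OF z out disjI1[OF refl]] by blast
  have z': "z' = zk" "rho < norm vh" using s(8) by (auto split: if_splits)
  have "rho \<le> 2 * norm (zk - z) / sqrt lam * K"
    using sref_residual_bound[OF lip z s(1,2,3,4,6,7)] z'(2) unfolding K_def by linarith
  then have "rho\<^sup>2 \<le> (2 * norm (zk - z) / sqrt lam * K)\<^sup>2" using rho by (intro power_mono) auto
  also have "\<dots> = 16 * K\<^sup>2 * (((norm (zk - z))\<^sup>2 / 4) / lam)"
    using lam by (simp add: power_mult_distrib power_divide)
  also have "\<dots> \<le> 16 * K\<^sup>2 * ((lam * (phir z - phir zk)) / lam)"
    using aicg_step_descent[OF z s(1,3,5)] lam by (intro mult_left_mono divide_right_mono) auto
  also have "\<dots> = 16 * K\<^sup>2 * (phir z - phir zk)" using lam by simp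
  finally show "rho\<^sup>2 \<le> 16 * (sqrt lam * L1 + (1 + theta * C_bar lam M2 L1 L2) / sqrt lam)\<^sup>2
                   * (phir z - phir z')"
    unfolding K_def z'(1) .
qed

lemma aicg_outer_Stop_True:
  assumes z: "z \<in> Z" and out: "aicg_outer f1 f2 h M2 rho lam theta z0 z = Stop (zh, v, True)"
  shows "\<exists>vh. v = Some vh \<and> vh \<in> {grad f1 zh + grad f2 zh + s | s. s \<in> subdiff h zh} \<and> norm vh \<le> rho"
proof -
  obtain zk vk zh' vh where s: "sref f1 f2 h lam M2 zk z vk = (zh', vh)"
    "Stop (zh, v, True) = (if norm vh \<le> rho then Stop (zh', Some vh, True) else Continue zk)"
    using aicg_outer_accepted[OF z out disjI2[OF refl]] by blast
  then have eq: "zh = zh'" "v = Some vh" "norm vh \<le> rho" by (auto split: if_splits)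
  have "vh = grad f1 zh + grad f2 zh + (vh - grad f1 zh - grad f2 zh)" by simp
  then show ?thesis using sref_subgradient[OF s(1)] eq by blast
qed

text \<open>\<open>D\<close> supplies the curvature inequalities at every search point that precedes
  the return. S.ACG then reports success, and its \<open>Delta\<close> bound, valid on all of
  \<open>Z\<close>, holds in particular at the prox center \<open>z\<close>.\<close>

lemma aicg_outer_convex:
  assumes z: "z \<in> Z" and D: "Z \<subseteq> D" "convex_on D f2" "curv_class m2 M2 D f2"
    and search: "sacg_search_points (aicg_psi_s f1 f2 lam z) (aicg_psi_n h lam) z theta 1 (aicg_L lam M2) \<subseteq> D"
    and out: "aicg_outer f1 f2 h M2 rho lam theta z0 z = Stop (zh, v, b)"
  shows "b = True"
proof -
  let ?s = "aicg_psi_s f1 f2 lam z" and ?n = "aicg_psi_n h lam" and ?L = "aicg_L lam M2"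
  obtain o' where sacg: "sacg ?s ?n z theta 1 ?L = Some o'"
    using out unfolding aicg_outer_def Let_def by (auto split: option.splits)
  then obtain k where k: "k \<ge> 1" "sacg_return ?s ?n z theta 1 ?L k = Some o'"
    "\<And>j. 1 \<le> j \<Longrightarrow> j < k \<Longrightarrow> sacg_return ?s ?n z theta 1 ?L j = None"
    using sacg_SomeD by blast
  \<comment> \<open>The search point of state \<open>j\<close> produces iterate
    \<open>j + 1\<close>, so a return in iteration \<open>k\<close> involves exactly the indices
    below \<open>k\<close>.\<close>
  have xD: "acg_xt 1 ?L (acg_iter ?s ?n z 1 ?L j) \<in> D" if "j < k" for j
  proof -
    have "\<forall>i. 1 \<le> i \<and> i \<le> j \<longrightarrow> sacg_return ?s ?n z theta 1 ?L i = None"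
      using k(3) that by (meson le_less_trans)
    then show ?thesis using search unfolding sacg_search_points_def by blast
  qed
  have lower: "lin ?s x u + 1 / 2 * (norm (u - x))\<^sup>2 \<le> ?s u" if "x \<in> D" "u \<in> Z" for x u
  proof -
    have g: "GDERIV f2 x :> grad f2 x" by (rule curv_class_gderiv[OF D(3) that(1)])
    have "0 \<le> lam * (f2 u - lin f2 x u)"
      using convex_on_above_gradient[OF D(2) that(1) _ g, of u] that(2) D(1) lam by auto
    then show ?thesis using aicg_psi_s_linearization_gap[OF g, of f1 lam z u] by linarith
  qed
  have upper: "?s u \<le> lin ?s x u + ?L / 2 * (norm (u - x))\<^sup>2" if "x \<in> D" "u \<in> Z" for x u
    by (rule aicg_psi_s_curvature_upper[OF D(3) that(1) subsetD[OF D(1) that(2)] lam])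
  have "\<exists>y w e. o' = (y, Some w, ereal e, True) \<and> y \<in> Z \<and> (\<forall>u\<in>Z. Delta ?s ?n 1 u y w \<le> ereal e)"
    by (rule sacg_return_convex[OF h z lam aicg_L_pos k(1) lower[OF xD] upper[OF xD] k(2)])
  then obtain y w e where "o' = (y, Some w, ereal e, True)" "Delta ?s ?n 1 z y w \<le> ereal e"
    using z by blast
  then show ?thesis
    using out unfolding aicg_outer_def Let_def sacg
    by (auto split: if_splits prod.splits simp: not_less[symmetric])
qed

section \<open>Counting the outer iterations\<close>

lemma aicg_iter_mem:
  assumes "z0 \<in> Z" "aicg_iter f1 f2 h M2 rho lam theta z0 k = Some z"
  shows "z \<in> Z"
  using assms(2)
proof (induction k arbitrary: z)
  case (Suc k)
  then obtain z1 where "aicg_iter f1 f2 h M2 rho lam theta z0 k = Some z1"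
    "aicg_outer f1 f2 h M2 rho lam theta z0 z1 = Continue z"
    by (auto split: option.splits outer_result.splits)
  then show ?case using Suc.IH aicg_outer_Continue_mem by blast
qed (use assms(1) in simp)

lemma aicg_iter_descent:
  assumes lip: "L1-lipschitz_on Z (grad f1)" "L2-lipschitz_on Z (grad f2)"
    and z0: "z0 \<in> Z" and it: "aicg_iter f1 f2 h M2 rho lam theta z0 k = Some z"
  shows "real k * rho\<^sup>2 \<le> 16 * (sqrt lam * L1 + (1 + theta * C_bar lam M2 L1 L2) / sqrt lam)\<^sup>2
                   * (phir z0 - phir z)"
  using it
proof (induction k arbitrary: z)
  case (Suc k)
  then obtain z1 where z1: "aicg_iter f1 f2 h M2 rho lam theta z0 k = Some z1"
    "aicg_outer f1 f2 h M2 rho lam theta z0 z1 = Continue z"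
    by (auto split: option.splits outer_result.splits)
  show ?case
    using Suc.IH[OF z1(1)] aicg_outer_Continue[OF lip aicg_iter_mem[OF z0 z1(1)] z1(2)]
    by (simp add: algebra_simps)
qed simp

lemma aicg_stops_bound:
  assumes lip: "L1-lipschitz_on Z (grad f1)" "L2-lipschitz_on Z (grad f2)"
    and z0: "z0 \<in> Z" and below: "\<And>u. u \<in> Z \<Longrightarrow> c \<le> phir u"
  shows "\<exists>N res. aicg_stops f1 f2 h M2 rho lam theta z0 N res \<and>
           is_bigO N ((sqrt lam * L1 + (1 + theta * C_bar lam M2 L1 L2) / sqrt lam)\<^sup>2
                        * ((phir z0 - c) / rho\<^sup>2))"
proof -
  let ?it = "aicg_iter f1 f2 h M2 rho lam theta z0"
  define K where "K = sqrt lam * L1 + (1 + theta * C_bar lam M2 L1 L2) / sqrt lam"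
  define B where "B = K\<^sup>2 * ((phir z0 - c) / rho\<^sup>2)"
  have bound: "real k \<le> 16 * B" if "?it k = Some z" for k z
  proof -
    have "real k * rho\<^sup>2 \<le> 16 * K\<^sup>2 * (phir z0 - phir z)"
      unfolding K_def by (rule aicg_iter_descent[OF lip z0 that])
    also have "\<dots> \<le> 16 * K\<^sup>2 * (phir z0 - c)"
      using below[OF aicg_iter_mem[OF z0 that]] by (intro mult_left_mono) auto
    finally show ?thesis using rho by (simp add: B_def field_simps)
  qed
  obtain m :: nat where "16 * B < real m" using reals_Archimedean2 by blast
  then have "?it m = None" using bound[of m] by (cases "?it m") fastforce+
  \<comment> \<open>An index at which the run breaks off: an iterate exists, its successor does not.
    As S.ACG cannot diverge, the iteration starting there stops.\<close>
  moreover have "?it 0 \<noteq> None" by simp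
  ultimately obtain n where n: "?it n \<noteq> None" "?it (Suc n) = None"
    using dec_induct[of 0 m "\<lambda>k. ?it k \<noteq> None"] by blast
  then obtain z where z: "?it n = Some z" by blast
  then obtain res where "aicg_outer f1 f2 h M2 rho lam theta z0 z = Stop res"
    using n(2) aicg_outer_not_diverges[OF aicg_iter_mem[OF z0 z]]
    by (cases "aicg_outer f1 f2 h M2 rho lam theta z0 z") auto
  then have "aicg_stops f1 f2 h M2 rho lam theta z0 (Suc n) res"
    unfolding aicg_stops_def using z by blast
  \<comment> \<open>The stopping iteration adds one to \<open>16 * B\<close>, so 17 times
    \<open>max 1 B\<close> would do; \<open>bigO_const\<close> is larger.\<close>
  moreover have "is_bigO (Suc n) B"
    using bound[OF z] unfolding is_bigO_def bigO_const_def by simp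
  ultimately show ?thesis unfolding B_def K_def by blast
qed

end

theorem theorem7p3p1:
  fixes Z :: "'a::euclidean_space set"
    and f1 f2 :: "'a \<Rightarrow> real"
    and h :: "'a \<Rightarrow> ereal"
    and m1 M1 m2 M2 L1 L2 rho lam theta :: real
    and z0 :: 'a
  assumes "Z \<noteq> {}" and "convex Z"
    and "conv_class Z h"
    and "curv_class m1 M1 Z f1"
    and "curv_class m2 M2 Z f2"
    and "phi_star f1 f2 h > - \<infinity>"
    and "L1 = curv_max m1 M1" and "L2 = curv_max m2 M2"
    and "rho > 0" and "z0 \<in> Z" and "lam > 0" and "0 < theta" and "theta < 1"
    and "lam * M1 + theta\<^sup>2 < 1 / 2"
  shows
    "(lipschitz_gradients Z f1 L1 f2 L2 \<longrightarrow>
        (\<exists>N res. aicg_stops f1 f2 h M2 rho lam theta z0 N res \<and>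
           is_bigO N ((sqrt lam * L1 + (1 + theta * C_bar lam M2 L1 L2) / sqrt lam)\<^sup>2
                        * (real_of_ereal (phi f1 f2 h z0 - phi_star f1 f2 h) / rho\<^sup>2)))) \<and>
     (\<forall>N zh v. aicg_stops f1 f2 h M2 rho lam theta z0 N (zh, v, True) \<longrightarrow>
        (\<exists>vh. v = Some vh \<and>
           vh \<in> {grad f1 zh + grad f2 zh + s | s. s \<in> subdiff h zh} \<and> norm vh \<le> rho)) \<and>
     (lipschitz_gradients Z f1 L1 f2 L2 \<and> convex_along_run Z f1 f2 h m2 M2 rho lam theta z0 \<longrightarrow>
        (\<exists>N zh v. aicg_stops f1 f2 h M2 rho lam theta z0 N (zh, v, True)))"
proof -
  note h = assms(3) and f1 = assms(4) and f2 = assms(5)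
  note run = h f1 f2 assms(7-9) assms(11-14)
  let ?stops = "aicg_stops f1 f2 h M2 rho lam theta z0"
  define phir where "phir u = f1 u + f2 u + real_of_ereal (h u)" for u
  have phi: "phi f1 f2 h u = ereal (phir u)" if "u \<in> Z" for u
    unfolding phi_def phir_def by (subst conv_class_eq_real[OF h that]) simp
  have star_le: "phi_star f1 f2 h \<le> ereal (phir u)" if "u \<in> Z" for u
    unfolding phi_star_def phi[OF that, symmetric] by (rule INF_lower) simp
  \<comment> \<open>The infimum is finite: bounded below by assumption and above by the value at
    \<open>z0\<close>.\<close>
  obtain c where c: "phi_star f1 f2 h = ereal c"
    using assms(6) star_le[OF \<open>z0 \<in> Z\<close>] by (cases "phi_star f1 f2 h") auto
  have gap: "real_of_ereal (phi f1 f2 h z0 - phi_star f1 f2 h) = phir z0 - c"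
    unfolding phi[OF \<open>z0 \<in> Z\<close>] c by simp
  have a: "\<exists>N res. ?stops N res \<and>
      is_bigO N ((sqrt lam * L1 + (1 + theta * C_bar lam M2 L1 L2) / sqrt lam)\<^sup>2
                   * (real_of_ereal (phi f1 f2 h z0 - phi_star f1 f2 h) / rho\<^sup>2))"
    if lip: "lipschitz_gradients Z f1 L1 f2 L2"
  proof -
    have "L1-lipschitz_on Z (grad f1)" "L2-lipschitz_on Z (grad f2)"
      using lip curv_class_gradient_lipschitz[OF \<open>convex Z\<close> _ f1]
        curv_class_gradient_lipschitz[OF \<open>convex Z\<close> _ f2] assms(7,8)
      unfolding lipschitz_gradients_def by auto
    then show ?thesis
      unfolding gap phir_def
      by (rule aicg_stops_bound[OF run])
         (use \<open>z0 \<in> Z\<close> star_le in \<open>auto simp: c phir_def\<close>)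
  qed
  have b: "\<exists>vh. v = Some vh \<and>
      vh \<in> {grad f1 zh + grad f2 zh + s | s. s \<in> subdiff h zh} \<and> norm vh \<le> rho"
    if "?stops N (zh, v, True)" for N zh v
    using that aicg_outer_Stop_True[OF run] aicg_iter_mem[OF run \<open>z0 \<in> Z\<close>]
    unfolding aicg_stops_def by blast
  have c: "\<exists>N zh v. ?stops N (zh, v, True)"
    if lip: "lipschitz_gradients Z f1 L1 f2 L2"
      and conv: "convex_along_run Z f1 f2 h m2 M2 rho lam theta z0"
  proof -
    \<comment> \<open>Termination is already known, so only the flag \<open>b\<close> of the output
      has to be examined.\<close>
    obtain N zh v b where stop: "?stops N (zh, v, b)" using a[OF lip] by (metis prod_cases3)
    then obtain k z where z: "aicg_iter f1 f2 h M2 rho lam theta z0 k = Some z"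
      "aicg_outer f1 f2 h M2 rho lam theta z0 z = Stop (zh, v, b)"
      unfolding aicg_stops_def by blast
    obtain D where D: "Z \<subseteq> D" "aicg_search_points f1 f2 h M2 rho lam theta z0 \<subseteq> D"
      "convex_on D f2" "curv_class m2 M2 D f2"
      using conv unfolding convex_along_run_def by blast
    have "sacg_search_points (aicg_psi_s f1 f2 lam z) (aicg_psi_n h lam) z theta 1 (aicg_L lam M2) \<subseteq> D"
      using D(2) z(1) unfolding aicg_search_points_def by blast
    then have "b = True"
      using aicg_outer_convex[OF run aicg_iter_mem[OF run \<open>z0 \<in> Z\<close> z(1)] D(1,3,4) _ z(2)] by blast
    then show ?thesis using stop by blast
  qed
  show ?thesis using a b c by blast
qed

end
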